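(* Let $L=K_1\cup\dots\cup K_\mu$ be a (virtual) link. Then the total multivariate Alexander quandle $U(L)$ is isomorphic, as a quandle, to $\mathrm{Conj}(G(L)/G(L)'')$, the conjugation quandle of the metabelian quotient of the link group $G(L)$. Moreover, there is a quandle isomorphism $U(L)\cong \mathrm{Conj}(G(L)/G(L)'')$ that maps the fundamental multivariate Alexander quandle $Q_A(L)$ isomorphically onto the natural image of the fundamental quandle $Q(L)$ in $G(L)/G(L)''$.
   Context: Links. A (virtual) link diagram $D$ consists of a finite number $\mu$ of oriented circles, indexed $1,\dots,\mu$ and immersed in the plane with only transverse double points (crossings). Each crossing is either classical (one of the two strands is underpassing, the other overpassing; short subsegments are removed from the underpassing strand on the two sides of the crossing point) or virtual (marked by a small circle; the two strands are thought of as not meeting there). The removals at classical crossings cut the circles into arcs (arcs pass through virtual crossings unbroken; a circle that never underpasses is a single arc). $A(D)$ is the set of arcs and $C(D)$ the set of classical crossings. A (virtual) link $L=K_1\cup\dots\cup K_\mu$ is an equivalence class of such diagrams under Reidemeister moves (on classical crossings) and detour moves (a segment of a strand whose only crossings are virtual may be replaced by any other generically immersed segment with the same endpoints, all new crossings being virtual); the component $K_i$ is represented by the $i$th circle. At $c\in C(D)$, $a(c)$ denotes the overpassing arc, and $b_1(c),b_2(c)$ the two underpassing arcs, with $b_1(c)$ on the right of the oriented arc $a(c)$ and $b_2(c)$ on the left. Let $\kappa_D:A(D)\to\{1,\dots,\mu\}$, $\kappa_D(a)=i$ if $a$ belongs to $K_i$. All structures below are defined from a diagram $D$ of $L$ and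 are independent of $D$ up to isomorphism. Quandles. A quandle is a set with a binary operation $\triangleright$ such that $x\triangleright x=x$, each map $x\mapsto x\triangleright y$ is a bijection, and $(x\triangleright y)\triangleright z=(x\triangleright z)\triangleright(y\triangleright z)$. For a group $G$, $\mathrm{Conj}(G)$ is the set $G$ with $x\triangleright y=yxy^{-1}$. The subquandle generated by a subset is the smallest subset containing it and closed under $\triangleright$ and under the inverse operation (the inverses of the maps $x\mapsto x\triangleright y$). Fundamental quandle and group. $Q(L)$ is the quandle with a generator $q_a$ for each $a\in A(D)$ and a relation $q_{b_1(c)}\triangleright q_{a(c)}=q_{b_2(c)}$ for each $c\in C(D)$. $G(L)$ is the group with a generator $g_a$ for each $a\in A(D)$ and a relation $g_{a(c)}g_{b_1(c)}g_{a(c)}^{-1}g_{b_2(c)}^{-1}=1$ for each $c\in C(D)$. $G(L)'$ is the commutator subgroup of $G(L)$ and $G(L)''$ is the commutator subgroup of $G(L)'$. The natural image of $Q(L)$ in $G(L)/G(L)''$ is the image of the quandle homomorphism $Q(L)\to\mathrm{Conj}(G(L)/G(L)'')$ with $q_a\mapsto g_aG(L)''$ for all $a\in A(D)$. Alexander module and quandles. Let $\Lambda_\mu=\mathbb Z[t_1^{\pm1},\dots,t_\mu^{\pm1}]$, and let $I_\mu$ be the ideal generated by $t_1-1,\dots,t_\mu-1$. Let $\rho_D:\Lambda_\mu^{C(D)}\to\Lambda_\mu^{A(D)}$ be the $\Lambda_\mu$-linear map of free modules with $\rho_D(c)=(1-t_{\kappa_D(b_1(c))})a(c)+t_{\kappa_D(a(c))}b_1(c)-b_2(c)$.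 The Alexander module $M_A(L)$ is the cokernel of $\rho_D$, with canonical surjection $\gamma_D:\Lambda_\mu^{A(D)}\to M_A(L)$. The Crowell map $\phi_L:M_A(L)\to I_\mu$ is the $\Lambda_\mu$-linear map with $\phi_L(\gamma_D(a))=t_{\kappa_D(a)}-1$ for all $a\in A(D)$. The total multivariate Alexander quandle is $U(L)=\{x\in M_A(L)\mid \phi_L(x)+1\text{ is a unit of }\Lambda_\mu\}$ with the operation $x\triangleright y=(\phi_L(y)+1)x-\phi_L(x)y$. The fundamental multivariate Alexander quandle $Q_A(L)$ is the subquandle of $U(L)$ generated by $\{\gamma_D(a)\mid a\in A(D)\}$. *)

theory Defs
  imports
    "HOL-Analysis.Smooth_Paths"
    "HOL-Algebra.Generated_Groups"
    "HOL-Algebra.AbelCoset"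
    "HOL-Algebra.Module"
    "HOL-Library.Poly_Mapping"
begin

section \<open>Virtual link diagrams\<close>

text \<open>
  The components are indexed by a finite type \<open>'m\<close>, so that \<open>\<mu> = CARD('m)\<close>.
  The \<open>i\<close>-th circle is a copy of the unit circle, oriented counterclockwise, and
  \<open>curve D i\<close> (relevant on the unit circle only) is its immersion in the oriented plane.
  A point \<open>(i, z)\<close> of the disjoint union of the circles belongs to \<open>underpasses D\<close> if
  the \<open>i\<close>-th strand is underpassing at \<open>z\<close>. A double point is a classical crossing if one
  of its two preimages is an underpass, and a virtual crossing if neither is.
\<close>

record 'm link_diagram =
  curve :: "'m \<Rightarrow> complex \<Rightarrow> complex"
  underpasses :: "('m \<times> complex) set"

definition circle_points :: "('m \<times> complex) set" where
  "circle_points = UNIV \<times> sphere 0 1"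

definition position :: "'m link_diagram \<Rightarrow> 'm \<times> complex \<Rightarrow> complex" where
  "position D p = curve D (fst p) (snd p)"

definition velocity :: "'m link_diagram \<Rightarrow> 'm \<times> complex \<Rightarrow> complex" where
  "velocity D p = vector_derivative (\<lambda>s. curve D (fst p) (snd p * cis s)) (at 0)"

definition double_pair :: "'m link_diagram \<Rightarrow> 'm \<times> complex \<Rightarrow> 'm \<times> complex \<Rightarrow> bool" where
  "double_pair D p q \<longleftrightarrow>
     p \<in> circle_points \<and> q \<in> circle_points \<and> p \<noteq> q \<and> position D p = position D q"

text \<open>
  For plane vectors \<open>v\<close> and \<open>w\<close>, the number \<open>Im (cnj v * w)\<close> is the determinant of \<open>(v, w)\<close>.
\<close>

definition virtual_link_diagram :: "'m link_diagram \<Rightarrow> bool" where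
  "virtual_link_diagram D \<longleftrightarrow>
     (\<forall>i. (\<lambda>s. curve D i (cis s)) C1_differentiable_on UNIV) \<and>
     (\<forall>p \<in> circle_points. velocity D p \<noteq> 0) \<and>
     finite {p. \<exists>q. double_pair D p q} \<and>
     (\<forall>p q r. double_pair D p q \<longrightarrow> double_pair D p r \<longrightarrow> q = r) \<and>
     (\<forall>p q. double_pair D p q \<longrightarrow> Im (cnj (velocity D p) * velocity D q) \<noteq> 0) \<and>
     (\<forall>p \<in> underpasses D. \<exists>q. double_pair D p q \<and> q \<notin> underpasses D)"

definition crossings :: "'m link_diagram \<Rightarrow> complex set" where
  "crossings D = position D ` underpasses D"

definition under_point :: "'m link_diagram \<Rightarrow> complex \<Rightarrow> 'm \<times> complex" where
  "under_point D c = (THE p. p \<in> underpasses D \<and> position D p = c)"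

definition over_point :: "'m link_diagram \<Rightarrow> complex \<Rightarrow> 'm \<times> complex" where
  "over_point D c = (THE p. p \<in> circle_points - underpasses D \<and> position D p = c)"

text \<open>
  Removing a short segment around each underpass leaves the same arcs as removing the underpass
  itself; an arc is recorded with the index of its circle.
\<close>

type_synonym 'm arc = "'m \<times> complex set"

definition cut_circle :: "'m link_diagram \<Rightarrow> 'm \<Rightarrow> complex set" where
  "cut_circle D i = sphere 0 1 - {z. (i, z) \<in> underpasses D}"

definition arcs :: "'m link_diagram \<Rightarrow> 'm arc set" where
  "arcs D = (SIGMA i:UNIV. components (cut_circle D i))"

definition comp_of :: "'m arc \<Rightarrow> 'm" where
  "comp_of a = fst a"

definition over_arc :: "'m link_diagram \<Rightarrow> complex \<Rightarrow> 'm arc" where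
  "over_arc D c = (case over_point D c of (i, z) \<Rightarrow>
     (i, connected_component_set (cut_circle D i) z))"

text \<open>
  The underpassing arc that leaves (\<open>e = 1\<close>) or enters (\<open>e = -1\<close>) the crossing \<open>c\<close>:
\<close>

definition under_arc :: "'m link_diagram \<Rightarrow> complex \<Rightarrow> real \<Rightarrow> 'm arc" where
  "under_arc D c e = (case under_point D c of (i, z) \<Rightarrow>
     (i, THE S. S \<in> components (cut_circle D i) \<and>
                (\<forall>\<^sub>F s in at_right 0. z * cis (e * s) \<in> S)))"

text \<open>
  The sign is \<open>1\<close> if the understrand crosses the overstrand from right to left, and \<open>-1\<close> if it
  crosses from left to right. So \<open>right_arc\<close>, the underpassing
  arc on the right of the overstrand, is the incoming underpassing arc
  at a positive crossing and the outgoing one at a negative crossing.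
\<close>

definition crossing_sign :: "'m link_diagram \<Rightarrow> complex \<Rightarrow> real" where
  "crossing_sign D c =
     sgn (Im (cnj (velocity D (over_point D c)) * velocity D (under_point D c)))"

definition right_arc :: "'m link_diagram \<Rightarrow> complex \<Rightarrow> 'm arc" where
  "right_arc D c = under_arc D c (- crossing_sign D c)"

definition left_arc :: "'m link_diagram \<Rightarrow> complex \<Rightarrow> 'm arc" where
  "left_arc D c = under_arc D c (crossing_sign D c)"

lemma crossing_points:
  assumes D: "virtual_link_diagram D" and c: "c \<in> crossings D"
  shows under_point: "under_point D c \<in> underpasses D" "position D (under_point D c) = c"
    and over_point: "over_point D c \<in> circle_points - underpasses D" "position D (over_point D c) = c"
    and double_pair_crossing: "double_pair D (over_point D c) (under_point D c)"
proof -
  obtain p where p: "p \<in> underpasses D" "position D p = c"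
    using c by (auto simp: crossings_def)
  obtain q where q: "double_pair D p q" "q \<notin> underpasses D"
    using D p unfolding virtual_link_diagram_def by blast
  have uniq: "r = q" if "r \<in> circle_points" "position D r = c" "r \<noteq> p" for r
  proof -
    have "double_pair D p r" using that p q by (auto simp: double_pair_def)
    then show ?thesis using D q unfolding virtual_link_diagram_def by blast
  qed
  have sub: "r \<in> circle_points" if "r \<in> underpasses D" for r
    using D that unfolding virtual_link_diagram_def double_pair_def by blast
  have 1: "under_point D c = p"
    unfolding under_point_def using p q uniq sub by (intro the_equality) blast+
  have 2: "over_point D c = q"
    unfolding over_point_def using p q uniq by (intro the_equality) (auto simp: double_pair_def)
  show "under_point D c \<in> underpasses D" "position D (under_point D c) = c"
     "over_point D c \<in> circle_points - underpasses D" "position D (over_point D c) = c"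
     "double_pair D (over_point D c) (under_point D c)"
    using 1 2 p q by (auto simp: double_pair_def)
qed

lemma finite_underpasses:
  assumes "virtual_link_diagram D"
  shows "finite (underpasses D)"
proof (rule finite_subset)
  show "underpasses D \<subseteq> {p. \<exists>q. double_pair D p q}"
    using assms unfolding virtual_link_diagram_def by blast
  show "finite {p. \<exists>q. double_pair D p q}"
    using assms unfolding virtual_link_diagram_def by blast
qed

lemma over_arc_in_arcs:
  assumes "virtual_link_diagram D" "c \<in> crossings D"
  shows "over_arc D c \<in> arcs D"
  using over_point[OF assms]
  by (auto simp: over_arc_def arcs_def components_def cut_circle_def circle_points_def split: prod.splits)

lemma under_arc_unique:
  assumes D: "virtual_link_diagram D" and c: "c \<in> crossings D" and e: "\<bar>e\<bar> = 1"
    and p: "under_point D c = (i, z)"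
  shows "\<exists>!S. S \<in> components (cut_circle D i) \<and> (\<forall>\<^sub>F s in at_right 0. z * cis (e * s) \<in> S)"
proof -
  define F where "F = {w. (i, w) \<in> underpasses D}"
  have "F = snd ` (underpasses D \<inter> {i} \<times> UNIV)" by (force simp: F_def)
  then have finF: "finite F" using finite_underpasses[OF D] by simp
  have "(i, z) \<in> underpasses D" using under_point(1)[OF D c] p by simp
  then have "(i, z) \<in> circle_points"
    using D unfolding virtual_link_diagram_def double_pair_def by blast
  then have z: "norm z = 1" by (simp add: circle_points_def)
  have ev: "\<forall>\<^sub>F s in at_right 0. z * cis (e * s) \<noteq> w" for w
  proof (cases "w = z")
    case False
    have "((\<lambda>s. z * cis (e * s)) \<longlongrightarrow> z * cis (e * 0)) (at_right 0)"
      by (intro tendsto_intros)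
    then have "((\<lambda>s. z * cis (e * s)) \<longlongrightarrow> z) (at_right 0)" by simp
    then show ?thesis using False by (metis tendsto_imp_eventually_ne)
  next
    case True
    have "\<forall>\<^sub>F s in at_right (0::real). s \<in> {0<..<1}"
      by (intro eventually_at_right_real) simp
    then show ?thesis
    proof eventually_elim
      case (elim s)
      have "sin (e * s) \<noteq> 0"
      proof -
        have "sin s > 0" using elim by (intro sin_gt_zero_02) auto
        moreover have "e = 1 \<or> e = -1" using e by auto
        ultimately show ?thesis by auto
      qed
      then have "cis (e * s) \<noteq> 1" by (metis cis.sel(2) one_complex.sel(2))
      then show ?case using True z by auto
    qed
  qed
  have "\<forall>\<^sub>F s in at_right 0. \<forall>w\<in>F. z * cis (e * s) \<noteq> w"
    using finF ev by (simp add: eventually_ball_finite_distrib)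
  then obtain d where d: "d > 0" "\<And>s. 0 < s \<Longrightarrow> s < d \<Longrightarrow> z * cis (e * s) \<notin> F"
    unfolding eventually_at_right_field by blast
  define J where "J = (\<lambda>s. z * cis (e * s)) ` {0<..<d}"
  have "connected J"
    unfolding J_def by (intro connected_continuous_image continuous_intros) auto
  moreover have Jsub: "J \<subseteq> cut_circle D i"
    using d z by (auto simp: J_def cut_circle_def F_def norm_mult)
  moreover have "J \<noteq> {}" using d by (auto simp: J_def)
  ultimately obtain S where S: "S \<in> components (cut_circle D i)" "J \<subseteq> S"
    by (metis exists_component_superset Jsub subset_empty)
  have "\<forall>\<^sub>F s in at_right 0. s \<in> {0<..<d}"
    using d by (intro eventually_at_right_real) simp
  then have evS: "\<forall>\<^sub>F s in at_right 0. z * cis (e * s) \<in> S"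
    by eventually_elim (use S(2) in \<open>simp add: J_def image_subset_iff\<close>)
  show ?thesis
  proof (intro ex1I conjI)
    fix T assume T: "T \<in> components (cut_circle D i) \<and> (\<forall>\<^sub>F s in at_right 0. z * cis (e * s) \<in> T)"
    then have "\<forall>\<^sub>F s in at_right 0. z * cis (e * s) \<in> S \<inter> T"
      using evS by (auto elim: eventually_elim2)
    then have "S \<inter> T \<noteq> {}"
      using eventually_happens trivial_limit_at_right_real by (metis (no_types, lifting) empty_iff)
    then show "T = S" using components_eq S T by blast
  qed (use S evS in auto)
qed

lemma under_arc_in_arcs:
  assumes "virtual_link_diagram D" "c \<in> crossings D" "\<bar>e\<bar> = 1"
  shows "under_arc D c e \<in> arcs D"
proof (cases "under_point D c")
  case (Pair i z)
  from theI'[OF under_arc_unique[OF assms Pair]] show ?thesis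
    by (auto simp: under_arc_def arcs_def Pair)
qed

lemma crossing_sign:
  assumes D: "virtual_link_diagram D" and c: "c \<in> crossings D"
  shows "\<bar>crossing_sign D c\<bar> = 1"
proof -
  have "Im (cnj (velocity D (over_point D c)) * velocity D (under_point D c)) \<noteq> 0"
    using double_pair_crossing[OF D c] D unfolding virtual_link_diagram_def by blast
  then show ?thesis unfolding crossing_sign_def by (simp add: abs_sgn_eq)
qed

lemma crossing_arcs_in_arcs:
  assumes "virtual_link_diagram D" "c \<in> crossings D"
  shows "right_arc D c \<in> arcs D" "left_arc D c \<in> arcs D"
  using assms crossing_sign[OF assms]
  by (auto simp: right_arc_def left_arc_def intro!: under_arc_in_arcs)

lemma comp_of_under_arcs: "comp_of (right_arc D c) = comp_of (left_arc D c)"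
  by (simp add: comp_of_def right_arc_def left_arc_def under_arc_def split: prod.splits)

lemma virtual_link_diagram_circle:
  "virtual_link_diagram \<lparr>curve = (\<lambda>_::unit. id), underpasses = {}\<rparr>"
proof -
  have d: "((\<lambda>s. z * cis s) has_vector_derivative z * \<i> * cis s) (at s)" for z s
  proof -
    have "((\<lambda>s. z * exp (s *\<^sub>R \<i>)) has_vector_derivative z * (exp (s *\<^sub>R \<i>) * \<i>)) (at s)"
      by (intro has_vector_derivative_mult_right exp_scaleR_has_vector_derivative_right)
    then show ?thesis by (simp add: cis_conv_exp scaleR_conv_of_real mult_ac)
  qed
  have "(\<lambda>s. cis s) C1_differentiable_on UNIV"
    unfolding C1_differentiable_on_def
    by (rule exI[of _ "\<lambda>s. \<i> * cis s"]) (use d[of 1] in \<open>auto intro!: continuous_intros\<close>)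
  moreover have "vector_derivative (\<lambda>s. z * cis s) (at 0) = z * \<i>" for z
    using d[of z 0] by (simp add: vector_derivative_at)
  moreover have "\<not> double_pair \<lparr>curve = (\<lambda>_::unit. id), underpasses = {}\<rparr> p q" for p q
    by (auto simp: double_pair_def position_def prod_eq_iff)
  ultimately show ?thesis
    by (auto simp: virtual_link_diagram_def velocity_def circle_points_def)
qed


section \<open>Quandles\<close>

record 'a quandle = "'a partial_object" +
  qop :: "'a \<Rightarrow> 'a \<Rightarrow> 'a" (infixl \<open>\<triangleright>\<index>\<close> 70)

locale quandle =
  fixes Q (structure)
  assumes closed: "\<lbrakk>x \<in> carrier Q; y \<in> carrier Q\<rbrakk> \<Longrightarrow> x \<triangleright> y \<in> carrier Q"
    and idem: "x \<in> carrier Q \<Longrightarrow> x \<triangleright> x = x"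
    and bij: "y \<in> carrier Q \<Longrightarrow> bij_betw (\<lambda>x. x \<triangleright> y) (carrier Q) (carrier Q)"
    and distrib: "\<lbrakk>x \<in> carrier Q; y \<in> carrier Q; z \<in> carrier Q\<rbrakk> \<Longrightarrow>
      (x \<triangleright> y) \<triangleright> z = (x \<triangleright> z) \<triangleright> (y \<triangleright> z)"

definition quandle_hom :: "('a, 'c) quandle_scheme \<Rightarrow> ('b, 'd) quandle_scheme \<Rightarrow> ('a \<Rightarrow> 'b) set" where
  "quandle_hom Q R = {h \<in> carrier Q \<rightarrow> carrier R.
     \<forall>x \<in> carrier Q. \<forall>y \<in> carrier Q. h (x \<triangleright>\<^bsub>Q\<^esub> y) = h x \<triangleright>\<^bsub>R\<^esub> h y}"

definition quandle_iso :: "('a, 'c) quandle_scheme \<Rightarrow> ('b, 'd) quandle_scheme \<Rightarrow> ('a \<Rightarrow> 'b) set" where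
  "quandle_iso Q R = {h \<in> quandle_hom Q R. bij_betw h (carrier Q) (carrier R)}"

definition Conj :: "('a, 'b) monoid_scheme \<Rightarrow> 'a quandle" where
  "Conj G = \<lparr>carrier = carrier G, qop = (\<lambda>x y. y \<otimes>\<^bsub>G\<^esub> x \<otimes>\<^bsub>G\<^esub> inv\<^bsub>G\<^esub> y)\<rparr>"

inductive_set subquandle_gen :: "('a, 'b) quandle_scheme \<Rightarrow> 'a set \<Rightarrow> 'a set"
  for Q :: "('a, 'b) quandle_scheme" and S :: "'a set"
where
  base: "x \<in> S \<Longrightarrow> x \<in> subquandle_gen Q S"
| op: "\<lbrakk>x \<in> subquandle_gen Q S; y \<in> subquandle_gen Q S\<rbrakk> \<Longrightarrow> x \<triangleright>\<^bsub>Q\<^esub> y \<in> subquandle_gen Q S"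
| inv_op: "\<lbrakk>x \<in> subquandle_gen Q S; y \<in> subquandle_gen Q S; z \<in> carrier Q; z \<triangleright>\<^bsub>Q\<^esub> y = x\<rbrakk>
    \<Longrightarrow> z \<in> subquandle_gen Q S"

lemma quandle_Conj:
  assumes "group G"
  shows "quandle (Conj G)"
proof -
  interpret group G by fact
  have c1: "inv\<^bsub>G\<^esub> y \<otimes>\<^bsub>G\<^esub> (y \<otimes>\<^bsub>G\<^esub> x) = x" "y \<otimes>\<^bsub>G\<^esub> (inv\<^bsub>G\<^esub> y \<otimes>\<^bsub>G\<^esub> x) = x"
    if "x \<in> carrier G" "y \<in> carrier G" for x y
    using that by (simp_all flip: m_assoc)
  show ?thesis
  proof
    fix y assume y: "y \<in> carrier (Conj G)"
    show "bij_betw (\<lambda>x. x \<triangleright>\<^bsub>Conj G\<^esub> y) (carrier (Conj G)) (carrier (Conj G))"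
      by (rule bij_betw_byWitness[where f' = "\<lambda>x. inv\<^bsub>G\<^esub> y \<otimes>\<^bsub>G\<^esub> x \<otimes>\<^bsub>G\<^esub> y"])
         (use y in \<open>auto simp: Conj_def m_assoc c1\<close>)
  qed (auto simp: Conj_def m_assoc inv_mult_group c1)
qed


section \<open>Quandles and groups given by presentations\<close>

datatype 'a qterm = Gen 'a | Op "'a qterm" "'a qterm" | Inv_op "'a qterm" "'a qterm"

inductive qterm_eq :: "'a set \<Rightarrow> ('a qterm \<times> 'a qterm) set \<Rightarrow> 'a qterm \<Rightarrow> 'a qterm \<Rightarrow> bool"
  for X :: "'a set" and R :: "('a qterm \<times> 'a qterm) set"
where
  refl: "set_qterm x \<subseteq> X \<Longrightarrow> qterm_eq X R x x"
| sym: "qterm_eq X R x y \<Longrightarrow> qterm_eq X R y x"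
| trans: "\<lbrakk>qterm_eq X R x y; qterm_eq X R y z\<rbrakk> \<Longrightarrow> qterm_eq X R x z"
| op: "\<lbrakk>qterm_eq X R x x'; qterm_eq X R y y'\<rbrakk> \<Longrightarrow> qterm_eq X R (Op x y) (Op x' y')"
| inv_op: "\<lbrakk>qterm_eq X R x x'; qterm_eq X R y y'\<rbrakk> \<Longrightarrow> qterm_eq X R (Inv_op x y) (Inv_op x' y')"
| idem: "set_qterm x \<subseteq> X \<Longrightarrow> qterm_eq X R (Op x x) x"
| inv1: "\<lbrakk>set_qterm x \<subseteq> X; set_qterm y \<subseteq> X\<rbrakk> \<Longrightarrow> qterm_eq X R (Inv_op (Op x y) y) x"
| inv2: "\<lbrakk>set_qterm x \<subseteq> X; set_qterm y \<subseteq> X\<rbrakk> \<Longrightarrow> qterm_eq X R (Op (Inv_op x y) y) x"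
| distrib: "\<lbrakk>set_qterm x \<subseteq> X; set_qterm y \<subseteq> X; set_qterm z \<subseteq> X\<rbrakk> \<Longrightarrow>
    qterm_eq X R (Op (Op x y) z) (Op (Op x z) (Op y z))"
| rel: "\<lbrakk>(x, y) \<in> R; set_qterm x \<subseteq> X; set_qterm y \<subseteq> X\<rbrakk> \<Longrightarrow> qterm_eq X R x y"

definition qterm_rel :: "'a set \<Rightarrow> ('a qterm \<times> 'a qterm) set \<Rightarrow> ('a qterm \<times> 'a qterm) set" where
  "qterm_rel X R = {(x, y). qterm_eq X R x y}"

definition presented_quandle :: "'a set \<Rightarrow> ('a qterm \<times> 'a qterm) set \<Rightarrow> 'a qterm set quandle" where
  "presented_quandle X R =
     \<lparr>carrier = {x. set_qterm x \<subseteq> X} // qterm_rel X R,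
      qop = (\<lambda>A B. \<Union>x\<in>A. \<Union>y\<in>B. qterm_rel X R `` {Op x y})\<rparr>"

lemma qterm_eq_set: "qterm_eq X R x y \<Longrightarrow> set_qterm x \<subseteq> X \<and> set_qterm y \<subseteq> X"
  by (induction rule: qterm_eq.induct) auto

lemma equiv_qterm_rel: "equiv {x. set_qterm x \<subseteq> X} (qterm_rel X R)"
  by (rule equivI)
     (auto simp: qterm_rel_def refl_on_def sym_def trans_def dest: qterm_eq_set
           intro: qterm_eq.refl qterm_eq.sym qterm_eq.trans)

lemma presented_quandle_op:
  assumes "set_qterm x \<subseteq> X" "set_qterm y \<subseteq> X"
  shows "(qterm_rel X R `` {x}) \<triangleright>\<^bsub>presented_quandle X R\<^esub> (qterm_rel X R `` {y}) = qterm_rel X R `` {Op x y}"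
  unfolding presented_quandle_def quandle.simps
proof (rule UN_equiv_class2[OF equiv_qterm_rel equiv_qterm_rel])
  show "congruent2 (qterm_rel X R) (qterm_rel X R) (\<lambda>x y. qterm_rel X R `` {Op x y})"
    unfolding congruent2_def
    by (auto intro!: equiv_class_eq[OF equiv_qterm_rel]) (auto simp: qterm_rel_def intro: qterm_eq.op)
qed (use assms in auto)

lemma quandle_presented_quandle: "quandle (presented_quandle X R)"
proof
  let ?Q = "presented_quandle X R" and ?c = "\<lambda>x. qterm_rel X R `` {x}"
  have car: "carrier ?Q = ?c ` {x. set_qterm x \<subseteq> X}"
    by (auto simp: presented_quandle_def quotient_def)
  have eq: "?c x = ?c y \<longleftrightarrow> qterm_eq X R x y" if "set_qterm x \<subseteq> X" "set_qterm y \<subseteq> X" for x y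
    by (subst eq_equiv_class_iff[OF equiv_qterm_rel]) (use that in \<open>auto simp: qterm_rel_def\<close>)
  note op = presented_quandle_op[where X = X and R = R]
  have eqI: "?c x = ?c y" if "qterm_eq X R x y" for x y
    using that by (intro equiv_class_eq[OF equiv_qterm_rel]) (simp add: qterm_rel_def)
  have rep: "\<exists>x. set_qterm x \<subseteq> X \<and> A = ?c x" if "A \<in> carrier ?Q" for A
    using that unfolding car by (elim imageE CollectE) (intro exI conjI)
  show "A \<triangleright>\<^bsub>?Q\<^esub> B \<in> carrier ?Q" if AB: "A \<in> carrier ?Q" "B \<in> carrier ?Q" for A B
  proof -
    obtain x y where "set_qterm x \<subseteq> X" "A = ?c x" "set_qterm y \<subseteq> X" "B = ?c y"
      using rep[OF AB(1)] rep[OF AB(2)] by iprover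
    then show ?thesis unfolding car by (simp add: op)
  qed
  show "A \<triangleright>\<^bsub>?Q\<^esub> A = A" if A: "A \<in> carrier ?Q" for A
  proof -
    obtain x where "set_qterm x \<subseteq> X" "A = ?c x" using rep[OF A] by iprover
    then show ?thesis by (simp only: op eqI[OF qterm_eq.idem])
  qed
  show "A \<triangleright>\<^bsub>?Q\<^esub> B \<triangleright>\<^bsub>?Q\<^esub> C = A \<triangleright>\<^bsub>?Q\<^esub> C \<triangleright>\<^bsub>?Q\<^esub> (B \<triangleright>\<^bsub>?Q\<^esub> C)"
    if ABC: "A \<in> carrier ?Q" "B \<in> carrier ?Q" "C \<in> carrier ?Q" for A B C
  proof -
    obtain x y z where *: "set_qterm x \<subseteq> X" "A = ?c x" "set_qterm y \<subseteq> X" "B = ?c y"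
        "set_qterm z \<subseteq> X" "C = ?c z"
      using rep[OF ABC(1)] rep[OF ABC(2)] rep[OF ABC(3)] by iprover
    then have "set_qterm (Op x y) \<subseteq> X" "set_qterm (Op x z) \<subseteq> X" "set_qterm (Op y z) \<subseteq> X" by auto
    with * show ?thesis by (simp only: op eqI[OF qterm_eq.distrib])
  qed
  fix B assume "B \<in> carrier ?Q"
  from rep[OF this] obtain y where y: "set_qterm y \<subseteq> X" "B = ?c y" by iprover
  have inj: "qterm_eq X R x x'" if "qterm_eq X R (Op x y) (Op x' y)" "set_qterm x \<subseteq> X" "set_qterm x' \<subseteq> X" for x x'
    using qterm_eq.inv_op[OF that(1) qterm_eq.refl[OF y(1)]] qterm_eq.inv1[OF that(2) y(1)]
       qterm_eq.inv1[OF that(3) y(1)] by (meson qterm_eq.sym qterm_eq.trans)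
  show "bij_betw (\<lambda>A. A \<triangleright>\<^bsub>?Q\<^esub> B) (carrier ?Q) (carrier ?Q)"
  proof (rule bij_betw_imageI)
    show "inj_on (\<lambda>A. A \<triangleright>\<^bsub>?Q\<^esub> B) (carrier ?Q)"
    proof (rule inj_onI)
      fix A A' assume A: "A \<in> carrier ?Q" and A': "A' \<in> carrier ?Q" and e: "A \<triangleright>\<^bsub>?Q\<^esub> B = A' \<triangleright>\<^bsub>?Q\<^esub> B"
      from rep[OF A] rep[OF A'] obtain x x' where x: "set_qterm x \<subseteq> X" "A = ?c x" "set_qterm x' \<subseteq> X" "A' = ?c x'"
        by iprover
      have "?c (Op x y) = ?c (Op x' y)" using e x y by (simp only: op)
      then have "qterm_eq X R (Op x y) (Op x' y)"
        by (subst (asm) eq) (use x y in simp_all)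
      from eqI[OF inj[OF this]] x show "A = A'" by simp
    qed
    show "(\<lambda>A. A \<triangleright>\<^bsub>?Q\<^esub> B) ` carrier ?Q = carrier ?Q"
    proof (intro equalityI subsetI)
      fix A assume "A \<in> (\<lambda>A. A \<triangleright>\<^bsub>?Q\<^esub> B) ` carrier ?Q"
      then obtain x where "set_qterm x \<subseteq> X" "A = ?c x \<triangleright>\<^bsub>?Q\<^esub> B"
        using rep by (elim imageE) metis
      then show "A \<in> carrier ?Q" using y unfolding car by (simp add: op)
    next
      fix A assume "A \<in> carrier ?Q"
      from rep[OF this] obtain x where x: "set_qterm x \<subseteq> X" "A = ?c x" by iprover
      then have s: "set_qterm (Inv_op x y) \<subseteq> X" using y by simp
      show "A \<in> (\<lambda>A. A \<triangleright>\<^bsub>?Q\<^esub> B) ` carrier ?Q"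
      proof (rule image_eqI)
        show "A = ?c (Inv_op x y) \<triangleright>\<^bsub>?Q\<^esub> B"
          using x y s by (simp only: op eqI[OF qterm_eq.inv2])
        show "?c (Inv_op x y) \<in> carrier ?Q" using s unfolding car by simp
      qed
    qed
  qed
qed

text \<open>
  In a group word, \<open>(x, True)\<close> stands for the generator \<open>x\<close> and \<open>(x, False)\<close> for its inverse.
\<close>

type_synonym 'a word = "('a \<times> bool) list"

inductive word_eq :: "'a set \<Rightarrow> 'a word set \<Rightarrow> 'a word \<Rightarrow> 'a word \<Rightarrow> bool"
  for X :: "'a set" and R :: "'a word set"
where
  refl: "u \<in> lists (X \<times> UNIV) \<Longrightarrow> word_eq X R u u"
| sym: "word_eq X R u v \<Longrightarrow> word_eq X R v u"
| trans: "\<lbrakk>word_eq X R u v; word_eq X R v w\<rbrakk> \<Longrightarrow> word_eq X R u w"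
| mult: "\<lbrakk>word_eq X R u u'; word_eq X R v v'\<rbrakk> \<Longrightarrow> word_eq X R (u @ v) (u' @ v')"
| cancel: "x \<in> X \<Longrightarrow> word_eq X R [(x, b), (x, \<not> b)] []"
| rel: "\<lbrakk>r \<in> R; r \<in> lists (X \<times> UNIV)\<rbrakk> \<Longrightarrow> word_eq X R r []"

definition word_rel :: "'a set \<Rightarrow> 'a word set \<Rightarrow> ('a word \<times> 'a word) set" where
  "word_rel X R = {(u, v). word_eq X R u v}"

definition presented_group :: "'a set \<Rightarrow> 'a word set \<Rightarrow> 'a word set monoid" where
  "presented_group X R =
     \<lparr>carrier = lists (X \<times> UNIV) // word_rel X R,
      mult = (\<lambda>A B. \<Union>u\<in>A. \<Union>v\<in>B. word_rel X R `` {u @ v}),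
      one = word_rel X R `` {[]}\<rparr>"

lemma word_eq_lists: "word_eq X R u v \<Longrightarrow> u \<in> lists (X \<times> UNIV) \<and> v \<in> lists (X \<times> UNIV)"
  by (induction rule: word_eq.induct) auto

lemma equiv_word_rel: "equiv (lists (X \<times> UNIV)) (word_rel X R)"
  by (rule equivI)
     (auto simp: word_rel_def refl_on_def sym_def trans_def dest: word_eq_lists
           intro: word_eq.refl word_eq.sym word_eq.trans)

lemma presented_group_mult:
  assumes "u \<in> lists (X \<times> UNIV)" "v \<in> lists (X \<times> UNIV)"
  shows "(word_rel X R `` {u}) \<otimes>\<^bsub>presented_group X R\<^esub> (word_rel X R `` {v}) = word_rel X R `` {u @ v}"
  unfolding presented_group_def monoid.simps
proof (rule UN_equiv_class2[OF equiv_word_rel equiv_word_rel _ assms])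
  show "congruent2 (word_rel X R) (word_rel X R) (\<lambda>u v. word_rel X R `` {u @ v})"
    unfolding congruent2_def
    by (auto intro!: equiv_class_eq[OF equiv_word_rel]) (auto simp: word_rel_def intro: word_eq.mult)
qed

lemma group_presented_group: "group (presented_group X R)"
proof (rule groupI)
  let ?G = "presented_group X R"
  have car: "carrier ?G = (\<lambda>u. word_rel X R `` {u}) ` lists (X \<times> UNIV)"
    by (auto simp: presented_group_def quotient_def)
  have one: "\<one>\<^bsub>?G\<^esub> = word_rel X R `` {[]}" by (simp add: presented_group_def)
  show "\<one>\<^bsub>?G\<^esub> \<in> carrier ?G" by (auto simp: one car)
  fix A assume A: "A \<in> carrier ?G"
  then obtain u where u: "u \<in> lists (X \<times> UNIV)" "A = word_rel X R `` {u}" by (auto simp: car)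
  show "\<one>\<^bsub>?G\<^esub> \<otimes>\<^bsub>?G\<^esub> A = A"
    unfolding one u(2) by (subst presented_group_mult) (use u in auto)
  have "\<exists>v. v \<in> lists (X \<times> UNIV) \<and> word_eq X R (v @ u) []" using u(1)
  proof (induction u rule: rev_induct)
    case Nil then show ?case by (auto intro!: exI[of _ "[]"] word_eq.refl)
  next
    case (snoc xb u)
    obtain x b where xb: "xb = (x, b)" by force
    from snoc obtain v where v: "v \<in> lists (X \<times> UNIV)" "word_eq X R (v @ u) []" by auto
    have x: "x \<in> X" using snoc xb by auto
    have "word_eq X R ([(x, \<not> b)] @ (v @ u) @ [(x, b)]) ([(x, \<not> b)] @ [] @ [(x, b)])"
      using v x by (intro word_eq.mult word_eq.refl) auto
    moreover have "word_eq X R [(x, \<not> b), (x, b)] []"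
      using word_eq.cancel[OF x, of R "\<not> b"] by simp
    ultimately have "word_eq X R (((x, \<not> b) # v) @ u @ [xb]) []"
      using xb by (auto intro: word_eq.trans)
    then show ?case using v x by (intro exI[of _ "(x, \<not> b) # v"]) auto
  qed
  then obtain v where v: "v \<in> lists (X \<times> UNIV)" "word_eq X R (v @ u) []" by blast
  show "\<exists>B\<in>carrier ?G. B \<otimes>\<^bsub>?G\<^esub> A = \<one>\<^bsub>?G\<^esub>"
  proof (rule bexI)
    have "word_rel X R `` {v @ u} = word_rel X R `` {[]}"
      using v by (intro equiv_class_eq[OF equiv_word_rel]) (simp add: word_rel_def)
    then show "(word_rel X R `` {v}) \<otimes>\<^bsub>?G\<^esub> A = \<one>\<^bsub>?G\<^esub>"
      using u v by (simp add: presented_group_mult one)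
  qed (use v in \<open>simp add: car\<close>)
  fix B assume "B \<in> carrier ?G"
  then obtain v where v: "v \<in> lists (X \<times> UNIV)" "B = word_rel X R `` {v}" by (auto simp: car)
  show "A \<otimes>\<^bsub>?G\<^esub> B \<in> carrier ?G"
    unfolding u v by (subst presented_group_mult) (use u v in \<open>auto simp: car\<close>)
  fix C assume "C \<in> carrier ?G"
  then obtain w where w: "w \<in> lists (X \<times> UNIV)" "C = word_rel X R `` {w}" by (auto simp: car)
  show "A \<otimes>\<^bsub>?G\<^esub> B \<otimes>\<^bsub>?G\<^esub> C = A \<otimes>\<^bsub>?G\<^esub> (B \<otimes>\<^bsub>?G\<^esub> C)"
    unfolding u(2) v(2) w(2) using u v w by (simp add: presented_group_mult)
qed


section \<open>The fundamental quandle and the group of a link\<close>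

definition quandle_relations :: "'m link_diagram \<Rightarrow> ('m arc qterm \<times> 'm arc qterm) set" where
  "quandle_relations D =
     (\<lambda>c. (Op (Gen (right_arc D c)) (Gen (over_arc D c)), Gen (left_arc D c))) ` crossings D"

definition fundamental_quandle :: "'m link_diagram \<Rightarrow> 'm arc qterm set quandle" where
  "fundamental_quandle D = presented_quandle (arcs D) (quandle_relations D)"

definition quandle_gen :: "'m link_diagram \<Rightarrow> 'm arc \<Rightarrow> 'm arc qterm set" where
  "quandle_gen D a = qterm_rel (arcs D) (quandle_relations D) `` {Gen a}"

definition group_relators :: "'m link_diagram \<Rightarrow> 'm arc word set" where
  "group_relators D =
     (\<lambda>c. [(over_arc D c, True), (right_arc D c, True),
           (over_arc D c, False), (left_arc D c, False)]) ` crossings D"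

definition link_group :: "'m link_diagram \<Rightarrow> 'm arc word set monoid" where
  "link_group D = presented_group (arcs D) (group_relators D)"

definition group_gen :: "'m link_diagram \<Rightarrow> 'm arc \<Rightarrow> 'm arc word set" where
  "group_gen D a = word_rel (arcs D) (group_relators D) `` {[(a, True)]}"

definition second_derived :: "('a, 'b) monoid_scheme \<Rightarrow> 'a set" where
  "second_derived G = derived G (derived G (carrier G))"

definition metabelian_quotient :: "('a, 'b) monoid_scheme \<Rightarrow> 'a set monoid" where
  "metabelian_quotient G = G Mod second_derived G"


section \<open>Free modules and their quotients\<close>

text \<open>
  \<open>('m \<Rightarrow>\<^sub>0 int) \<Rightarrow>\<^sub>0 int\<close> is the integral group ring of the free abelian group of exponent vectors,
  that is, the ring of integral Laurent polynomials in the variables indexed by \<open>'m\<close>.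
\<close>

type_synonym 'm laurent = "('m \<Rightarrow>\<^sub>0 int) \<Rightarrow>\<^sub>0 int"

definition var :: "'m \<Rightarrow> 'm laurent" where
  "var i = Poly_Mapping.single (Poly_Mapping.single i 1) 1"

text \<open>
  The record type \<open>module\<close> extends \<open>ring\<close>; the fields \<open>mult\<close> and \<open>one\<close> play no role here.
  The basis vector belonging to \<open>x\<close> in a free module is \<open>Poly_Mapping.single x 1\<close>.
\<close>

definition free_module :: "'a set \<Rightarrow> ('r::comm_ring_1, 'a \<Rightarrow>\<^sub>0 'r) module" where
  "free_module X =
     \<lparr>carrier = {f. Poly_Mapping.keys f \<subseteq> X}, mult = undefined, one = undefined,
      zero = 0, add = (+), smult = (\<lambda>r. Poly_Mapping.map ((*) r))\<rparr>"

definition quotient_module :: "('r, 'b) module \<Rightarrow> 'b set \<Rightarrow> ('r, 'b set) module" where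
  "quotient_module M N =
     \<lparr>carrier = a_rcosets\<^bsub>M\<^esub> N, mult = undefined, one = undefined,
      zero = N, add = set_add M, smult = (\<lambda>r X. \<Union>x\<in>X. N +>\<^bsub>M\<^esub> (r \<odot>\<^bsub>M\<^esub> x))\<rparr>"


section \<open>The Alexander module and the multivariate Alexander quandles\<close>

definition crossing_relation :: "'m link_diagram \<Rightarrow> complex \<Rightarrow> 'm arc \<Rightarrow>\<^sub>0 'm laurent" where
  "crossing_relation D c =
     Poly_Mapping.single (over_arc D c) (1 - var (comp_of (right_arc D c))) +
     Poly_Mapping.single (right_arc D c) (var (comp_of (over_arc D c))) -
     Poly_Mapping.single (left_arc D c) 1"

definition alexander_matrix_map ::
    "'m link_diagram \<Rightarrow> (complex \<Rightarrow>\<^sub>0 'm laurent) \<Rightarrow> ('m arc \<Rightarrow>\<^sub>0 'm laurent)" where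
  "alexander_matrix_map D f =
     (\<Sum>c\<in>Poly_Mapping.keys f.
        Poly_Mapping.map ((*) (Poly_Mapping.lookup f c)) (crossing_relation D c))"

definition alexander_relations :: "'m link_diagram \<Rightarrow> ('m arc \<Rightarrow>\<^sub>0 'm laurent) set" where
  "alexander_relations D = alexander_matrix_map D ` carrier (free_module (crossings D))"

definition alexander_module ::
    "'m link_diagram \<Rightarrow> ('m laurent, ('m arc \<Rightarrow>\<^sub>0 'm laurent) set) module" where
  "alexander_module D = quotient_module (free_module (arcs D)) (alexander_relations D)"

definition alexander_proj ::
    "'m link_diagram \<Rightarrow> ('m arc \<Rightarrow>\<^sub>0 'm laurent) \<Rightarrow> ('m arc \<Rightarrow>\<^sub>0 'm laurent) set" where
  "alexander_proj D f = alexander_relations D +>\<^bsub>free_module (arcs D)\<^esub> f"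

definition alexander_gen :: "'m link_diagram \<Rightarrow> 'm arc \<Rightarrow> ('m arc \<Rightarrow>\<^sub>0 'm laurent) set" where
  "alexander_gen D a = alexander_proj D (Poly_Mapping.single a 1)"

text \<open>
  The Crowell map is induced by the linear map on the free module that sends the basis vector
  of each arc \<open>a\<close> to \<open>var (comp_of a) - 1\<close>; that map is constant on the cosets.
\<close>

definition crowell_free :: "('m arc \<Rightarrow>\<^sub>0 'm laurent) \<Rightarrow> 'm laurent" where
  "crowell_free f =
     (\<Sum>a\<in>Poly_Mapping.keys f. Poly_Mapping.lookup f a * (var (comp_of a) - 1))"

definition crowell_map :: "('m arc \<Rightarrow>\<^sub>0 'm laurent) set \<Rightarrow> 'm laurent" where
  "crowell_map x = the_elem (crowell_free ` x)"

definition total_alexander_quandle ::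
    "'m link_diagram \<Rightarrow> ('m arc \<Rightarrow>\<^sub>0 'm laurent) set quandle" where
  "total_alexander_quandle D =
     \<lparr>carrier = {x \<in> carrier (alexander_module D). crowell_map x + 1 dvd 1},
      qop = (\<lambda>x y. ((crowell_map y + 1) \<odot>\<^bsub>alexander_module D\<^esub> x)
                   \<ominus>\<^bsub>alexander_module D\<^esub> (crowell_map x \<odot>\<^bsub>alexander_module D\<^esub> y))\<rparr>"

definition fundamental_alexander_quandle ::
    "'m link_diagram \<Rightarrow> ('m arc \<Rightarrow>\<^sub>0 'm laurent) set quandle" where
  "fundamental_alexander_quandle D =
     (total_alexander_quandle D)
       \<lparr>carrier := subquandle_gen (total_alexander_quandle D) (alexander_gen D ` arcs D)\<rparr>"

lemma abelian_group_free_module: "abelian_group (free_module X :: ('r::comm_ring_1, 'a \<Rightarrow>\<^sub>0 'r) module)"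
proof (rule abelian_groupI)
  fix f :: "'a \<Rightarrow>\<^sub>0 'r" assume "f \<in> carrier (free_module X)"
  then show "\<exists>g\<in>carrier (free_module X). g \<oplus>\<^bsub>free_module X\<^esub> f = \<zero>\<^bsub>free_module X\<^esub>"
    by (intro bexI[of _ "- f"]) (auto simp: free_module_def)
next
  fix f g :: "'a \<Rightarrow>\<^sub>0 'r" assume "f \<in> carrier (free_module X)" "g \<in> carrier (free_module X)"
  then show "f \<oplus>\<^bsub>free_module X\<^esub> g \<in> carrier (free_module X)"
    using Poly_Mapping.keys_add[of f g] by (auto simp: free_module_def)
qed (auto simp: free_module_def add_ac)

lemma lookup_map_mult:
  "Poly_Mapping.lookup (Poly_Mapping.map ((*) r) h) k = r * Poly_Mapping.lookup (h :: 'b \<Rightarrow>\<^sub>0 'c::comm_ring_1) k"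
  by (simp add: Poly_Mapping.map.rep_eq when_def)

lemma alexander_matrix_map_superset:
  assumes "finite A" "Poly_Mapping.keys f \<subseteq> A"
  shows "alexander_matrix_map D f =
    (\<Sum>c\<in>A. Poly_Mapping.map ((*) (Poly_Mapping.lookup f c)) (crossing_relation D c))"
proof -
  have 0: "Poly_Mapping.map ((*) 0) h = 0" for h :: "'b \<Rightarrow>\<^sub>0 'c::comm_ring_1"
    by (rule poly_mapping_eqI) (simp add: lookup_map_mult)
  show ?thesis unfolding alexander_matrix_map_def
    by (rule sum.mono_neutral_left) (use assms in \<open>auto simp: in_keys_iff 0\<close>)
qed

lemma map_mult_add_left:
  "Poly_Mapping.map ((*) (r + s)) h = Poly_Mapping.map ((*) r) h + Poly_Mapping.map ((*) s) (h :: 'b \<Rightarrow>\<^sub>0 'c::comm_ring_1)"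
  by (rule poly_mapping_eqI) (simp add: lookup_map_mult lookup_add algebra_simps when_def in_keys_iff)

lemma map_mult_add_right:
  "Poly_Mapping.map ((*) r) (g + h) = Poly_Mapping.map ((*) r) g + Poly_Mapping.map ((*) r) (h :: 'b \<Rightarrow>\<^sub>0 'c::comm_ring_1)"
  by (rule poly_mapping_eqI) (auto simp: lookup_map_mult lookup_add algebra_simps when_def in_keys_iff)

lemma map_mult_mult:
  "Poly_Mapping.map ((*) (r * s)) h = Poly_Mapping.map ((*) r) (Poly_Mapping.map ((*) s) (h :: 'b \<Rightarrow>\<^sub>0 'c::comm_ring_1))"
  by (rule poly_mapping_eqI) (auto simp: lookup_map_mult algebra_simps when_def in_keys_iff)

lemma keys_map_mult: "Poly_Mapping.keys (Poly_Mapping.map ((*) r) (h :: 'b \<Rightarrow>\<^sub>0 'c::comm_ring_1)) \<subseteq> Poly_Mapping.keys h"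
  by (auto simp: in_keys_iff lookup_map_mult)

lemma alexander_matrix_map_add:
  "alexander_matrix_map D (f + g) = alexander_matrix_map D f + alexander_matrix_map D g"
  using Poly_Mapping.keys_add[of f g]
  by (simp add: alexander_matrix_map_superset[of "Poly_Mapping.keys f \<union> Poly_Mapping.keys g"]
        lookup_add map_mult_add_left sum.distrib)

lemma alexander_matrix_map_smult:
  "alexander_matrix_map D (Poly_Mapping.map ((*) r) f) = Poly_Mapping.map ((*) r) (alexander_matrix_map D f)"
proof -
  have S: "Poly_Mapping.map ((*) r) (sum h A) = (\<Sum>x\<in>A. Poly_Mapping.map ((*) r) (h x))"
    for h :: "'b \<Rightarrow> 'c \<Rightarrow>\<^sub>0 'd::comm_ring_1" and r A
    by (induction A rule: infinite_finite_induct)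
       (auto simp: map_mult_add_right intro: poly_mapping_eqI simp: lookup_map_mult)
  show ?thesis
    by (subst alexander_matrix_map_superset[OF _ keys_map_mult])
       (auto simp: alexander_matrix_map_def S map_mult_mult[symmetric] lookup_map_mult intro!: sum.cong)
qed

lemma crowell_free_superset:
  assumes "finite A" "Poly_Mapping.keys f \<subseteq> A"
  shows "crowell_free f = (\<Sum>a\<in>A. Poly_Mapping.lookup f a * (var (comp_of a) - 1))"
  unfolding crowell_free_def
  by (rule sum.mono_neutral_left) (use assms in \<open>auto simp: in_keys_iff\<close>)

lemma crowell_free_add: "crowell_free (f + g) = crowell_free f + crowell_free g"
  using Poly_Mapping.keys_add[of f g]
  by (simp add: crowell_free_superset[of "Poly_Mapping.keys f \<union> Poly_Mapping.keys g"]
        lookup_add sum.distrib distrib_right)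

lemma crowell_free_smult: "crowell_free (Poly_Mapping.map ((*) r) f) = r * crowell_free f"
  by (subst crowell_free_superset[OF _ keys_map_mult])
     (auto simp: crowell_free_def lookup_map_mult sum_distrib_left mult.assoc in_keys_iff intro!: sum.cong)

lemma crowell_free_single: "crowell_free (Poly_Mapping.single a r) = r * (var (comp_of a) - 1)"
  by (subst crowell_free_superset[of "{a}"]) auto

lemma crowell_free_uminus: "crowell_free (- f) = - crowell_free f"
  using crowell_free_add[of f "- f"] by (simp add: crowell_free_def eq_neg_iff_add_eq_0 add.commute)

lemma crowell_free_crossing: "crowell_free (crossing_relation D c) = 0"
  unfolding crossing_relation_def diff_conv_add_uminus crowell_free_add crowell_free_uminus crowell_free_single
  by (simp add: comp_of_under_arcs algebra_simps)

lemma crowell_free_relations: "r \<in> alexander_relations D \<Longrightarrow> crowell_free r = 0"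
proof -
  have S: "crowell_free (sum h A) = (\<Sum>x\<in>A. crowell_free (h x))" for h :: "'b \<Rightarrow> 'm arc \<Rightarrow>\<^sub>0 'm laurent" and A
    by (induction A rule: infinite_finite_induct) (simp_all add: crowell_free_add, simp_all add: crowell_free_def)
  show "r \<in> alexander_relations D \<Longrightarrow> crowell_free r = 0"
    by (auto simp: alexander_relations_def alexander_matrix_map_def S crowell_free_smult crowell_free_crossing)
qed

lemma alexander_proj_eq: "alexander_proj D f = (\<lambda>r. r + f) ` alexander_relations D"
  by (auto simp: alexander_proj_def a_r_coset_def' free_module_def)

lemma zero_in_relations: "0 \<in> alexander_relations D"
  by (auto simp: alexander_relations_def free_module_def alexander_matrix_map_def intro!: image_eqI[of _ _ 0])

lemma crowell_map_proj: "crowell_map (alexander_proj D f) = crowell_free f"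
proof -
  have "crowell_free ` alexander_proj D f = {crowell_free f}"
    using zero_in_relations[of D]
    by (auto simp: alexander_proj_eq image_image crowell_free_add crowell_free_relations)
  then show ?thesis by (simp add: crowell_map_def)
qed

lemma crowell_map_gen: "crowell_map (alexander_gen D a) = var (comp_of a) - 1"
  by (simp add: alexander_gen_def crowell_map_proj crowell_free_single)

lemma relations_add: "r \<in> alexander_relations D \<Longrightarrow> s \<in> alexander_relations D \<Longrightarrow> r + s \<in> alexander_relations D"
proof -
  assume "r \<in> alexander_relations D" "s \<in> alexander_relations D"
  then obtain f g where "Poly_Mapping.keys f \<subseteq> crossings D" "r = alexander_matrix_map D f"
     "Poly_Mapping.keys g \<subseteq> crossings D" "s = alexander_matrix_map D g"
    by (auto simp: alexander_relations_def free_module_def)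
  then show ?thesis
    using Poly_Mapping.keys_add[of f g]
    by (auto simp: alexander_relations_def free_module_def alexander_matrix_map_add[symmetric] intro!: imageI)
qed

lemma relations_smult: "r \<in> alexander_relations D \<Longrightarrow> Poly_Mapping.map ((*) s) r \<in> alexander_relations D"
  using keys_map_mult
  by (fastforce simp: alexander_relations_def free_module_def alexander_matrix_map_smult[symmetric])

lemma relations_uminus: "r \<in> alexander_relations D \<Longrightarrow> - r \<in> alexander_relations D"
proof -
  have "- r = Poly_Mapping.map ((*) (-1)) r"
    by (rule poly_mapping_eqI) (simp add: lookup_map_mult)
  then show "r \<in> alexander_relations D \<Longrightarrow> - r \<in> alexander_relations D" using relations_smult by metis
qed

lemma proj_eq_iff: "alexander_proj D f = alexander_proj D g \<longleftrightarrow> f - g \<in> alexander_relations D"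
proof
  assume "alexander_proj D f = alexander_proj D g"
  moreover have "f \<in> alexander_proj D f" using zero_in_relations[of D] by (force simp: alexander_proj_eq)
  ultimately show "f - g \<in> alexander_relations D" by (auto simp: alexander_proj_eq)
next
  assume A: "f - g \<in> alexander_relations D"
  have "r + f \<in> alexander_proj D g" if "r \<in> alexander_relations D" for r
    unfolding alexander_proj_eq by (rule image_eqI[of _ _ "r + (f - g)"]) (use relations_add[OF that A] in auto)
  moreover have "r + g \<in> alexander_proj D f" if "r \<in> alexander_relations D" for r
    unfolding alexander_proj_eq by (rule image_eqI[of _ _ "r + - (f - g)"]) (use relations_add[OF that relations_uminus[OF A]] in auto)
  ultimately show "alexander_proj D f = alexander_proj D g" by (auto simp: alexander_proj_eq)
qed

lemma carrier_alexander_module: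
  "carrier (alexander_module D) = alexander_proj D ` {f. Poly_Mapping.keys f \<subseteq> arcs D}"
  by (auto simp: alexander_module_def quotient_module_def A_RCOSETS_def' alexander_proj_def free_module_def)

lemma alexander_module_add:
  "alexander_proj D f \<oplus>\<^bsub>alexander_module D\<^esub> alexander_proj D g = alexander_proj D (f + g)"
proof -
  have "r + f + (s + g) \<in> alexander_proj D (f + g)" if "r \<in> alexander_relations D" "s \<in> alexander_relations D" for r s
    unfolding alexander_proj_eq by (rule image_eqI[of _ _ "r + s"]) (use relations_add that in \<open>auto simp: add_ac\<close>)
  moreover have "\<exists>x\<in>alexander_relations D. \<exists>y\<in>alexander_relations D. r + (f + g) = x + f + (y + g)" if "r \<in> alexander_relations D" for r
    by (rule bexI[OF _ that], rule bexI[OF _ zero_in_relations]) (simp add: add_ac)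
  ultimately show ?thesis
    by (auto simp: alexander_module_def quotient_module_def set_add_def' free_module_def alexander_proj_eq)
qed

lemma alexander_module_smult:
  "r \<odot>\<^bsub>alexander_module D\<^esub> alexander_proj D f = alexander_proj D (Poly_Mapping.map ((*) r) f)"
proof -
  have "alexander_proj D (Poly_Mapping.map ((*) r) x) = alexander_proj D (Poly_Mapping.map ((*) r) f)"
    if "x \<in> alexander_proj D f" for x
    using that relations_smult by (auto simp: alexander_proj_eq[of D f] proj_eq_iff map_mult_add_right)
  moreover have "alexander_proj D f \<noteq> {}" using zero_in_relations[of D] by (auto simp: alexander_proj_eq)
  ultimately show ?thesis
    by (simp add: alexander_module_def quotient_module_def flip: alexander_proj_def) (simp add: free_module_def)
qed

lemma abelian_group_alexander_module:
  assumes "virtual_link_diagram D"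
  shows "abelian_group (alexander_module D)"
proof -
  have z: "\<zero>\<^bsub>alexander_module D\<^esub> = alexander_proj D 0"
    by (simp add: alexander_module_def quotient_module_def alexander_proj_eq)
  show ?thesis
  proof (rule abelian_groupI)
    fix x assume "x \<in> carrier (alexander_module D)"
    then obtain f where f: "Poly_Mapping.keys f \<subseteq> arcs D" "x = alexander_proj D f"
      by (auto simp: carrier_alexander_module)
    then show "\<exists>y\<in>carrier (alexander_module D). y \<oplus>\<^bsub>alexander_module D\<^esub> x = \<zero>\<^bsub>alexander_module D\<^esub>"
      by (intro bexI[of _ "alexander_proj D (- f)"]) (auto simp: alexander_module_add z carrier_alexander_module)
  next
    fix x y assume "x \<in> carrier (alexander_module D)" "y \<in> carrier (alexander_module D)"
    then show "x \<oplus>\<^bsub>alexander_module D\<^esub> y \<in> carrier (alexander_module D)"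
      using Poly_Mapping.keys_add by (fastforce simp: carrier_alexander_module alexander_module_add)
  qed (auto simp: carrier_alexander_module alexander_module_add z add_ac)
qed

lemma relations_in_free_module:
  assumes "virtual_link_diagram D"
  shows "alexander_relations D \<subseteq> carrier (free_module (arcs D))"
proof -
  have "Poly_Mapping.keys (crossing_relation D c) \<subseteq> arcs D" if "c \<in> crossings D" for c
    using over_arc_in_arcs[OF assms that] crossing_arcs_in_arcs[OF assms that]
    by (auto simp: crossing_relation_def in_keys_iff lookup_add lookup_minus lookup_single when_def split: if_splits)
  note K = this
  show ?thesis
  proof
    fix r assume "r \<in> alexander_relations D"
    then obtain f where f: "Poly_Mapping.keys f \<subseteq> crossings D" "r = alexander_matrix_map D f"
      by (auto simp: alexander_relations_def free_module_def)
    have "Poly_Mapping.keys r \<subseteq> (\<Union>c\<in>Poly_Mapping.keys f.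
        Poly_Mapping.keys (Poly_Mapping.map ((*) (Poly_Mapping.lookup f c)) (crossing_relation D c)))"
      unfolding f alexander_matrix_map_def by (rule keys_sum)
    also have "\<dots> \<subseteq> arcs D"
      by (intro UN_least order_trans[OF keys_map_mult] K) (use f(1) in blast)
    finally show "r \<in> carrier (free_module (arcs D))" by (simp add: free_module_def)
  qed
qed

lemma total_alexander_op:
  assumes D: "virtual_link_diagram D" and g: "Poly_Mapping.keys g \<subseteq> arcs D"
  shows "alexander_proj D f \<triangleright>\<^bsub>total_alexander_quandle D\<^esub> alexander_proj D g =
    alexander_proj D (Poly_Mapping.map ((*) (crowell_free g + 1)) f - Poly_Mapping.map ((*) (crowell_free f)) g)"
proof -
  interpret abelian_group "alexander_module D" by (rule abelian_group_alexander_module[OF D])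
  have z: "\<zero>\<^bsub>alexander_module D\<^esub> = alexander_proj D 0"
    by (simp add: alexander_module_def quotient_module_def alexander_proj_eq)
  have inv: "\<ominus>\<^bsub>alexander_module D\<^esub> alexander_proj D h = alexander_proj D (- h)" if "Poly_Mapping.keys h \<subseteq> arcs D" for h
    by (rule minus_equality) (use that in \<open>auto simp: alexander_module_add z carrier_alexander_module\<close>)
  have "Poly_Mapping.keys (Poly_Mapping.map ((*) (crowell_free f)) g) \<subseteq> arcs D"
    by (rule order_trans[OF keys_map_mult g])
  from inv[OF this] show ?thesis
    by (simp add: total_alexander_quandle_def crowell_map_proj alexander_module_smult a_minus_def
        alexander_module_add)
qed

lemma quandle_total_alexander_quandle:
  assumes D: "virtual_link_diagram D"
  shows "quandle (total_alexander_quandle D)"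
proof
  let ?U = "total_alexander_quandle D" and ?p = "alexander_proj D"
  define K where "K = {f. Poly_Mapping.keys f \<subseteq> arcs D \<and> crowell_free f + 1 dvd 1}"
  define op where "op f g = Poly_Mapping.map ((*) (crowell_free g + 1)) f - Poly_Mapping.map ((*) (crowell_free f)) g"
    for f g :: "'a arc \<Rightarrow>\<^sub>0 'a laurent"
  have car: "carrier ?U = ?p ` K"
    by (auto simp: K_def total_alexander_quandle_def carrier_alexander_module crowell_map_proj)
  have phi: "crowell_free (op f g) = crowell_free f" for f g :: "'a arc \<Rightarrow>\<^sub>0 'a laurent"
    unfolding op_def diff_conv_add_uminus crowell_free_add crowell_free_uminus crowell_free_smult
    by (simp add: algebra_simps)
  have U: "?p f \<triangleright>\<^bsub>?U\<^esub> ?p g = ?p (op f g)" if "g \<in> K" for f g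
    using total_alexander_op[OF D] that by (simp add: op_def K_def)
  have op_K: "op f g \<in> K" if "f \<in> K" "g \<in> K" for f g
  proof -
    have "Poly_Mapping.keys (op f g) \<subseteq> arcs D"
      unfolding op_def by (rule order_trans[OF keys_diff Un_least]; rule order_trans[OF keys_map_mult])
         (use that in \<open>auto simp: K_def\<close>)
    then show ?thesis using that by (simp add: K_def phi)
  qed
  show "x \<triangleright>\<^bsub>?U\<^esub> y \<in> carrier ?U" if "x \<in> carrier ?U" "y \<in> carrier ?U" for x y
    using that op_K by (auto simp: car U)
  show "x \<triangleright>\<^bsub>?U\<^esub> x = x" if "x \<in> carrier ?U" for x
  proof -
    have "op f f = f" for f :: "'a arc \<Rightarrow>\<^sub>0 'a laurent"
      by (rule poly_mapping_eqI) (simp add: op_def lookup_minus lookup_map_mult algebra_simps)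
    then show ?thesis using that by (auto simp: car U)
  qed
  show "x \<triangleright>\<^bsub>?U\<^esub> y \<triangleright>\<^bsub>?U\<^esub> z = x \<triangleright>\<^bsub>?U\<^esub> z \<triangleright>\<^bsub>?U\<^esub> (y \<triangleright>\<^bsub>?U\<^esub> z)"
    if "x \<in> carrier ?U" "y \<in> carrier ?U" "z \<in> carrier ?U" for x y z
  proof -
    have "op (op f g) h = op (op f h) (op g h)" for f g h :: "'a arc \<Rightarrow>\<^sub>0 'a laurent"
      by (rule poly_mapping_eqI, subst (1 3) op_def)
         (simp add: phi, simp add: op_def lookup_minus lookup_map_mult algebra_simps)
    then show ?thesis using that op_K by (auto simp: car U)
  qed
  fix y assume "y \<in> carrier ?U"
  then obtain g where g: "g \<in> K" "y = ?p g" by (auto simp: car)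
  then obtain u where u: "1 = (crowell_free g + 1) * u" by (auto simp: K_def elim: dvdE)
  define iop where "iop f = Poly_Mapping.map ((*) u) (f + Poly_Mapping.map ((*) (crowell_free f)) g)" for f
  have phi': "crowell_free (iop f) = crowell_free f" for f
  proof -
    have "crowell_free (iop f) = crowell_free f * ((crowell_free g + 1) * u)"
      by (simp add: iop_def crowell_free_add crowell_free_smult algebra_simps)
    then show ?thesis by (simp flip: u)
  qed
  have inv_K: "iop f \<in> K" if "f \<in> K" for f
  proof -
    have "Poly_Mapping.keys (Poly_Mapping.map ((*) (crowell_free f)) g) \<subseteq> arcs D"
      by (rule order_trans[OF keys_map_mult]) (use g in \<open>simp add: K_def\<close>)
    then have "Poly_Mapping.keys (iop f) \<subseteq> arcs D"
      unfolding iop_def using that g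
      by (intro order_trans[OF keys_map_mult] order_trans[OF Poly_Mapping.keys_add] Un_least)
         (auto simp: K_def)
    then show ?thesis using that by (simp add: K_def phi')
  qed
  have 1: "op (iop f) g = f" for f
  proof (rule poly_mapping_eqI)
    fix k
    have "Poly_Mapping.lookup (op (iop f) g) k =
       ((crowell_free g + 1) * u) * (Poly_Mapping.lookup f k + crowell_free f * Poly_Mapping.lookup g k)
        - crowell_free f * Poly_Mapping.lookup g k"
      by (subst op_def, simp add: phi', simp add: iop_def lookup_minus lookup_add lookup_map_mult algebra_simps)
    then show "Poly_Mapping.lookup (op (iop f) g) k = Poly_Mapping.lookup f k" by (simp flip: u)
  qed
  have 2: "iop (op f g) = f" for f
  proof (rule poly_mapping_eqI)
    fix k
    have "Poly_Mapping.lookup (iop (op f g)) k = ((crowell_free g + 1) * u) * Poly_Mapping.lookup f k"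
      by (subst iop_def, simp add: phi, simp add: op_def lookup_minus lookup_add lookup_map_mult algebra_simps)
    then show "Poly_Mapping.lookup (iop (op f g)) k = Poly_Mapping.lookup f k" by (simp flip: u)
  qed
  have cong: "?p (iop f) = ?p (iop f')" if "?p f = ?p f'" for f f'
  proof -
    have r: "f - f' \<in> alexander_relations D" using that by (simp add: proj_eq_iff)
    have "crowell_free f = crowell_free f'" using that crowell_map_proj by metis
    then have "iop f - iop f' = Poly_Mapping.map ((*) u) (f - f')"
      by (intro poly_mapping_eqI) (simp add: iop_def lookup_minus lookup_add lookup_map_mult algebra_simps)
    then show ?thesis using relations_smult[OF r] by (simp add: proj_eq_iff)
  qed
  show "bij_betw (\<lambda>x. x \<triangleright>\<^bsub>?U\<^esub> y) (carrier ?U) (carrier ?U)"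
  proof (rule bij_betw_imageI)
    show "inj_on (\<lambda>x. x \<triangleright>\<^bsub>?U\<^esub> y) (carrier ?U)"
    proof (rule inj_onI)
      fix a b assume "a \<in> carrier ?U" "b \<in> carrier ?U" and eq: "a \<triangleright>\<^bsub>?U\<^esub> y = b \<triangleright>\<^bsub>?U\<^esub> y"
      then obtain f f' where f: "a = ?p f" "b = ?p f'" by (auto simp: car)
      then have "?p (op f g) = ?p (op f' g)" using eq g by (simp add: U)
      from cong[OF this] show "a = b" by (simp add: 2 f)
    qed
    have "?p f \<in> (\<lambda>x. x \<triangleright>\<^bsub>?U\<^esub> y) ` carrier ?U" if "f \<in> K" for f
      by (rule image_eqI[of _ _ "?p (iop f)"]) (use g inv_K[OF that] in \<open>auto simp: U 1 car\<close>)
    then show "(\<lambda>x. x \<triangleright>\<^bsub>?U\<^esub> y) ` carrier ?U = carrier ?U"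
      using g op_K by (auto simp: car U)
  qed
qed

end

theory Submission
  imports Defs "HOL-Algebra.Free_Abelian_Groups"
begin

text \<open>
  The Fox derivative \<open>g \<mapsto> \<partial>g\<close> is a crossed homomorphism from the link group to the Alexander module whose
  composition with the Crowell map is \<open>g \<mapsto> ab(g) - 1\<close>, so its image lies in the total quandle, and
  \<open>\<partial>(y x y\<inverse>) = ab(y) \<partial>x - (ab(x) - 1) \<partial>y\<close> says that it is a quandle homomorphism from the conjugation
  quandle. It kills the second derived subgroup because it is additive on the commutator subgroup. That it
  kills nothing more follows from Reidemeister-Schreier rewriting, which recovers the class in \<open>G'/G''\<close> of
  an element of \<open>G'\<close> from its Fox derivative. It is onto the total quandle because the only units of
  the Laurent polynomial ring with augmentation 1 are the monomials, and because an element with Crowell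
  image \<open>ab(g) - 1\<close> differs from \<open>\<partial>g\<close> by the Fox derivative of an element of \<open>G'\<close>.
\<close>

section \<open>Units of the Laurent polynomial ring\<close>

lemma poly_mapping_sum_single:
  "(\<Sum>i\<in>Poly_Mapping.keys f. Poly_Mapping.single i (Poly_Mapping.lookup f i)) = f"
  by (rule poly_mapping_eqI) (auto simp: lookup_sum lookup_single when_def in_keys_iff)

text \<open>Only one pair of exponents contributes to the coefficient at \<open>a + b\<close>, so
  nothing can cancel there. The lemma is meant for the extreme exponents of the two factors.\<close>

lemma lookup_mult_unique:
  fixes p q :: "'k::comm_monoid_add \<Rightarrow>\<^sub>0 'r::comm_semiring_1"
  assumes "a \<in> Poly_Mapping.keys p" "b \<in> Poly_Mapping.keys q"
    and uniq: "\<And>i j. i \<in> Poly_Mapping.keys p \<Longrightarrow> j \<in> Poly_Mapping.keys q \<Longrightarrow> i + j = a + b \<Longrightarrow> i = a \<and> j = b"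
  shows "Poly_Mapping.lookup (p * q) (a + b) = Poly_Mapping.lookup p a * Poly_Mapping.lookup q b"
proof -
  have "p * q = (\<Sum>i\<in>Poly_Mapping.keys p. \<Sum>j\<in>Poly_Mapping.keys q.
      Poly_Mapping.single (i + j) (Poly_Mapping.lookup p i * Poly_Mapping.lookup q j))"
    by (subst (1) poly_mapping_sum_single[of p, symmetric], subst (1) poly_mapping_sum_single[of q, symmetric])
       (simp add: sum_product mult_single)
  then have "Poly_Mapping.lookup (p * q) (a + b) = (\<Sum>i\<in>Poly_Mapping.keys p. \<Sum>j\<in>Poly_Mapping.keys q.
      if i = a \<and> j = b then Poly_Mapping.lookup p i * Poly_Mapping.lookup q j else 0)"
    by (simp add: lookup_sum lookup_single when_def)
       (intro sum.cong refl, use uniq in auto)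
  also have "\<dots> = (\<Sum>i\<in>Poly_Mapping.keys p. if i = a then Poly_Mapping.lookup p a * Poly_Mapping.lookup q b else 0)"
    using assms(2) by (intro sum.cong refl) (auto simp: sum.delta)
  also have "\<dots> = Poly_Mapping.lookup p a * Poly_Mapping.lookup q b"
    using assms(1) by simp
  finally show ?thesis .
qed

lemma add_max_unique:
  fixes m n :: "'c::linordered_ab_group_add"
  assumes "x \<le> m" "y \<le> n" "x + y = m + n"
  shows "x = m" "y = n"
  using assms add_less_le_mono[of x m y n] add_le_less_mono[of x m y n] by (auto simp: order_le_less)

text \<open>
  The order pulled back along \<open>w\<close> makes the leading and the trailing terms of \<open>p * q\<close> products of
  such terms of the factors.
\<close>

lemma unit_single:
  fixes p q :: "'k::ab_group_add \<Rightarrow>\<^sub>0 'r::idom" and w :: "'k \<Rightarrow> 'c::linordered_ab_group_add"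
  assumes pq: "p * q = 1" and inj: "inj w" and add: "\<And>a b. w (a + b) = w a + w b"
  obtains e c where "p = Poly_Mapping.single e c"
proof -
  let ?P = "Poly_Mapping.keys p" and ?Q = "Poly_Mapping.keys q"
  have ne: "?P \<noteq> {}" "?Q \<noteq> {}" using pq by auto
  \<comment> \<open>The product of the two extreme terms survives in \<open>p * q = 1\<close>, whose
    only exponent is 0. The weight \<open>v\<close> is kept general so that \<open>- w\<close> can
    replace \<open>w\<close>, which turns trailing terms into leading ones.\<close>
  have ext: "v a + v b = 0"
    if v: "inj v" "\<And>a b. v (a + b) = v a + v b" and a: "a \<in> ?P" "\<And>i. i \<in> ?P \<Longrightarrow> v i \<le> v a"
      and b: "b \<in> ?Q" "\<And>i. i \<in> ?Q \<Longrightarrow> v i \<le> v b" for v :: "'k \<Rightarrow> 'c" and a b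
  proof -
    have "i = a \<and> j = b" if "i \<in> ?P" "j \<in> ?Q" "i + j = a + b" for i j
    proof -
      have "v i + v j = v a + v b" by (simp add: that(3) flip: v(2))
      note add_max_unique[OF a(2)[OF that(1)] b(2)[OF that(2)] this]
      then show ?thesis using injD[OF v(1)] by blast
    qed
    from lookup_mult_unique[OF a(1) b(1) this] have "Poly_Mapping.lookup 1 (a + b) \<noteq> (0::'r)"
      using a(1) b(1) unfolding pq in_keys_iff by (metis mult_eq_0_iff)
    then have "a + b = 0" by (simp add: lookup_one when_def split: if_splits)
    moreover have "v 0 = 0" using v(2)[of 0 0] by simp
    ultimately show ?thesis using v(2)[of a b] by simp
  qed
  have max: "\<exists>a\<in>A. \<forall>i\<in>A. v i \<le> v a" if "finite A" "A \<noteq> {}" for A and v :: "'k \<Rightarrow> 'c"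
    using that Max_in[of "v ` A"] Max_ge[of "v ` A"] by fastforce
  obtain a where a: "a \<in> ?P" "\<And>i. i \<in> ?P \<Longrightarrow> w i \<le> w a" using max[OF finite_keys ne(1), of w] by blast
  obtain b where b: "b \<in> ?Q" "\<And>i. i \<in> ?Q \<Longrightarrow> w i \<le> w b" using max[OF finite_keys ne(2), of w] by blast
  obtain a' where a': "a' \<in> ?P" "\<And>i. i \<in> ?P \<Longrightarrow> w a' \<le> w i"
    using max[OF finite_keys ne(1), of "\<lambda>i. - w i"] by auto
  obtain b' where b': "b' \<in> ?Q" "\<And>i. i \<in> ?Q \<Longrightarrow> w b' \<le> w i"
    using max[OF finite_keys ne(2), of "\<lambda>i. - w i"] by auto
  have 1: "w a + w b = 0" using ext[OF inj add a b] .
  have "- w a' + - w b' = 0"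
  proof (rule ext)
    show "inj (\<lambda>i. - w i)" using inj by (simp add: inj_def)
  qed (use a' b' in \<open>simp_all add: add\<close>)
  \<comment> \<open>The smallest weights of the two factors have the same sum as the largest ones,
    so smallest and largest coincide in \<open>p\<close>. As \<open>w\<close> is injective,
    \<open>p\<close> has a single exponent.\<close>
  then have "w a' + w b' = w a + w b" using 1 by (metis add.inverse_inverse minus_add_distrib minus_zero)
  from add_max_unique(1)[OF a(2)[OF a'(1)] b(2)[OF b'(1)] this] have "w a' = w a" .
  then have "i = a" if "i \<in> ?P" for i
    using a(2)[OF that] a'(2)[OF that] injD[OF inj] by force
  then have "p = Poly_Mapping.single a (Poly_Mapping.lookup p a)"
    by (intro poly_mapping_eqI) (auto simp: lookup_single when_def in_keys_iff)
  then show thesis by (rule that)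
qed

text \<open>Numbering the variables embeds the exponent vectors into
  \<open>nat \<Rightarrow>\<^sub>0 int\<close>, which is a linearly ordered group, so
  \<open>unit_single\<close> applies.\<close>

lemma laurent_unit:
  fixes p :: "'m::finite laurent"
  assumes "p dvd 1"
  obtains e c where "p = Poly_Mapping.single e c"
proof -
  obtain q where q: "p * q = 1" using assms by (auto elim!: dvdE)
  obtain idx :: "'m \<Rightarrow> nat" where idx: "inj idx"
    using finite_imp_inj_to_nat_seg[OF finite_class.finite_UNIV] by auto
  define w where "w = frag_extend (frag_of \<circ> idx)"
  have look: "Poly_Mapping.lookup (w x) (idx i) = Poly_Mapping.lookup x i" for x i
    unfolding w_def
    by (rule frag_induction[OF subset_UNIV, of _ x])
       (simp_all add: frag_extend_diff lookup_minus inj_eq[OF idx])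
  have "inj w"
    by (rule injI, rule poly_mapping_eqI) (metis look)
  moreover have "w (x + y) = w x + w y" for x y
    by (simp add: w_def frag_extend_add)
  ultimately show thesis
    using unit_single[OF q] that by metis
qed

text \<open>The values of \<open>crowell_free\<close> lie in the augmentation ideal. The unit
  therefore has augmentation 1, and this fixes the coefficient left open by
  \<open>laurent_unit\<close>.\<close>

lemma unit_crowell_free:
  fixes f :: "'m::finite arc \<Rightarrow>\<^sub>0 'm laurent"
  assumes "crowell_free f + 1 dvd 1"
  obtains e where "crowell_free f + 1 = Poly_Mapping.single e 1"
proof -
  \<comment> \<open>The augmentation, with all variables set to 1. The type
    \<open>unit \<Rightarrow>\<^sub>0 int\<close> is a copy of the integers that makes
    \<open>frag_extend\<close> available.\<close>
  define aug :: "'m laurent \<Rightarrow> (unit \<Rightarrow>\<^sub>0 int)" where "aug = frag_extend (\<lambda>_. frag_of ())"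
  have aug: "aug (p * (var i - 1)) = 0" for p i
    by (rule frag_induction[OF subset_UNIV, of _ p])
       (auto simp: aug_def var_def right_diff_distrib left_diff_distrib mult_single frag_extend_diff)
  have "aug (crowell_free f) = 0"
    unfolding crowell_free_def aug_def by (subst frag_extend_sum) (simp_all add: aug[unfolded aug_def])
  moreover have "aug 1 = frag_of ()"
    by (simp add: aug_def flip: single_one)
  moreover obtain e c where ec: "crowell_free f + 1 = Poly_Mapping.single e c"
    using laurent_unit[OF assms] by blast
  moreover have "aug (Poly_Mapping.single e c) = frag_cmul c (frag_of ())"
    by (simp add: aug_def frag_extend_def)
  ultimately have "frag_cmul c (frag_of ()) = frag_of ()"
    by (metis add_0 aug_def frag_extend_add)
  then have "c = 1"
    by (metis lookup_frag_cmul lookup_frag_of mult.right_neutral)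
  then show thesis using ec that by simp
qed

section \<open>Arcs of a component\<close>

text \<open>On the way around a circle the arc changes only at underpasses, where one underpassing
  arc of a crossing gives way to the other.\<close>

lemma arc_invariant_const:
  fixes f :: "'m arc \<Rightarrow> 'b"
  assumes D: "virtual_link_diagram D" and a: "a \<in> arcs D" and a': "a' \<in> arcs D"
    and comp: "comp_of a = comp_of a'"
    and inv: "\<And>c. c \<in> crossings D \<Longrightarrow> f (right_arc D c) = f (left_arc D c)"
  shows "f a = f a'"
proof -
  define i where "i = comp_of a"
  define F where "F = {z. (i, z) \<in> underpasses D}"
  have "F = snd ` (underpasses D \<inter> {i} \<times> UNIV)" by (force simp: F_def)
  then have finF: "finite F" using finite_underpasses[OF D] by simp
  let ?C = "cut_circle D i"
  have C: "cis s \<in> ?C \<longleftrightarrow> cis s \<notin> F" for s by (auto simp: cut_circle_def F_def)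
  \<comment> \<open>The invariant is pulled back to the real line, the universal cover of the
    circle, and filled in at the underpasses. It is locally constant there, hence constant because
    the line is connected.\<close>
  define g where "g s = (if cis s \<in> F then f (left_arc D (position D (i, cis s)))
     else f (i, connected_component_set ?C (cis s)))" for s
  have near: "\<forall>\<^sub>F s' in nhds s. g s = g s'" if s: "cis s \<notin> F" for s
  proof -
    have "open (cis -` (- F))"
      by (intro open_vimage) (use finF in \<open>auto simp: finite_imp_closed open_Compl intro!: continuous_intros\<close>)
    then obtain d where d: "d > 0" "ball s d \<subseteq> cis -` (- F)"
      using s openE[of "cis -` (- F)" s] by auto
    have "g s = g s'" if s': "s' \<in> ball s d" for s'
    proof -
      have sub: "cis ` ball s d \<subseteq> ?C" using d C by auto
      have "connected (cis ` ball s d)"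
        by (intro connected_continuous_image continuous_intros) auto
      then have "connected_component ?C (cis s) (cis s')"
        unfolding connected_component_def using sub s' d(1)
        by (intro exI[of _ "cis ` ball s d"]) auto
      then have "connected_component_set ?C (cis s) = connected_component_set ?C (cis s')"
        by (intro connected_component_eq[symmetric]) simp
      moreover have "cis s' \<notin> F" using s' d by auto
      ultimately show ?thesis using s by (simp add: g_def)
    qed
    moreover have "\<forall>\<^sub>F s' in nhds s. s' \<in> ball s d" using d by (intro eventually_nhds_in_open) auto
    ultimately show ?thesis by (auto elim: eventually_mono)
  qed
  have cross: "\<forall>\<^sub>F s' in at s. g s = g s'" if s: "cis s \<in> F" for s
  proof -
    define c where "c = position D (i, cis s)"
    have up: "(i, cis s) \<in> underpasses D" using s by (simp add: F_def)
    then have c: "c \<in> crossings D" by (auto simp: crossings_def c_def)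
    have u: "under_point D c = (i, cis s)"
      using under_point[OF D c] up D unfolding virtual_link_diagram_def c_def double_pair_def
      by (metis (no_types, lifting))
    have gs: "g s = f (left_arc D c)" using s by (simp add: g_def c_def)
    have side: "\<forall>\<^sub>F r in at_right 0. g s = g (s + e * r)" if e: "\<bar>e\<bar> = 1" for e :: real
    proof -
      \<comment> \<open>The arc met in direction \<open>e\<close> is the left one if
        \<open>e\<close> is the crossing sign and the right one otherwise.\<close>
      have f_e: "f (under_arc D c e) = f (left_arc D c)"
        using inv[OF c] e crossing_sign[OF D c] by (auto simp: right_arc_def left_arc_def abs_if split: if_splits)
      obtain S where S: "under_arc D c e = (i, S)" "S \<in> components ?C"
          "\<forall>\<^sub>F r in at_right 0. cis s * cis (e * r) \<in> S"
        using theI'[OF under_arc_unique[OF D c e u]] by (auto simp: under_arc_def u)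
      from S(3) show ?thesis
      proof eventually_elim
        case (elim r)
        then have r: "cis (s + e * r) \<in> S" by (simp add: cis_mult)
        then have "connected_component_set ?C (cis (s + e * r)) = S"
          using S(2) by (metis components_iff connected_component_eq)
        moreover have "cis (s + e * r) \<notin> F" using r S(2) C in_components_subset by blast
        ultimately show ?case using gs f_e S(1) by (simp add: g_def)
      qed
    qed
    have "\<forall>\<^sub>F r in at_right s. g s = g r"
      using side[of 1] by (subst at_right_to_0) (simp add: eventually_filtermap add.commute)
    moreover have "\<forall>\<^sub>F r in at_left s. g s = g r"
      using side[of "-1"] by (subst at_left_minus, subst at_right_to_0) (simp add: eventually_filtermap)
    ultimately show ?thesis by (simp add: eventually_at_split)
  qed
  have const: "g s = g s'" for s s'
  proof (rule connected_local_const[of UNIV])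
    show "\<forall>s\<in>UNIV. \<forall>\<^sub>F s' in at s. g s = g s'"
      using near cross by (metis eventually_nhds_conv_at)
  qed auto
  have rep: "\<exists>s. f b = g s" if "b \<in> arcs D" "comp_of b = i" for b
  proof -
    define S where "S = snd b"
    have S: "b = (i, S)" "S \<in> components ?C"
      using that by (auto simp: arcs_def comp_of_def S_def prod_eq_iff)
    then obtain z where z: "z \<in> ?C" "S = connected_component_set ?C z" by (auto simp: components_def)
    then obtain s where "z = cis s"
      by (auto simp: cut_circle_def) (metis cis_Arg norm_zero sgn_div_norm div_by_1 scaleR_one inverse_1 zero_neq_one)
    then show ?thesis using S z C by (intro exI[of _ s]) (simp add: g_def)
  qed
  show ?thesis using rep[OF a] rep[OF a'] const comp by (metis i_def)
qed

text \<open>A circle is infinite and has finitely many underpasses. It follows that each variable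
  comes from some generator of the link group.\<close>

lemma arc_exists:
  assumes D: "virtual_link_diagram D"
  obtains S where "(i, S) \<in> arcs D"
proof -
  have "{z. (i, z) \<in> underpasses D} = snd ` (underpasses D \<inter> {i} \<times> UNIV)" by force
  then have "finite {z. (i, z) \<in> underpasses D}" using finite_underpasses[OF D] by simp
  moreover have "infinite (sphere (0::complex) 1)"
    by (rule uncountable_infinite, rule connected_uncountable[of _ 1 "-1"]) (auto intro: connected_sphere)
  ultimately have "cut_circle D i \<noteq> {}"
    unfolding cut_circle_def by (metis Diff_infinite_finite finite.emptyI)
  then obtain z where "z \<in> cut_circle D i" by blast
  then show thesis using that by (auto simp: arcs_def components_def)
qed

section \<open>Scalar multiplication and additive maps\<close>

abbreviation scale :: "'r::comm_ring_1 \<Rightarrow> ('a \<Rightarrow>\<^sub>0 'r) \<Rightarrow> 'a \<Rightarrow>\<^sub>0 'r" (infixr \<open>\<cdot>\<close> 75) where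
  "r \<cdot> f \<equiv> Poly_Mapping.map ((*) r) f"

lemma scale_scale: "r \<cdot> s \<cdot> f = (r * s) \<cdot> f" for f :: "'a \<Rightarrow>\<^sub>0 'r::comm_ring_1"
  by (simp add: map_mult_mult)

lemma scale_uminus: "r \<cdot> (- f) = - (r \<cdot> f)" for f :: "'a \<Rightarrow>\<^sub>0 'r::comm_ring_1"
  by (rule poly_mapping_eqI) (simp add: lookup_map_mult)

lemma scale_diff: "r \<cdot> (f - g) = r \<cdot> f - r \<cdot> g" for f :: "'a \<Rightarrow>\<^sub>0 'r::comm_ring_1"
  by (rule poly_mapping_eqI) (simp add: lookup_map_mult lookup_minus right_diff_distrib)

text \<open>The second equation is needed because the simplifier turns \<open>(*) 1\<close> into the identity.\<close>

lemma scale_one: "1 \<cdot> f = f" "Poly_Mapping.map (\<lambda>x. x) f = f"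
  for f :: "'a \<Rightarrow>\<^sub>0 'r::comm_ring_1"
  by (rule poly_mapping_eqI; simp add: Poly_Mapping.map.rep_eq when_def)+

lemma scale_zero: "r \<cdot> 0 = (0 :: 'a \<Rightarrow>\<^sub>0 'r::comm_ring_1)"
  by (rule poly_mapping_eqI) (simp add: lookup_map_mult)

lemma scale_single: "r \<cdot> Poly_Mapping.single a s = Poly_Mapping.single a (r * s)"
  for s :: "'r::comm_ring_1"
  by (rule poly_mapping_eqI) (simp add: lookup_map_mult lookup_single when_def)

lemma scale_diff_left: "(r - s) \<cdot> f = r \<cdot> f - s \<cdot> f" for f :: "'a \<Rightarrow>\<^sub>0 'r::comm_ring_1"
  by (rule poly_mapping_eqI) (simp add: lookup_map_mult lookup_minus left_diff_distrib)

lemma scale_zero_left: "0 \<cdot> f = 0" for f :: "'a \<Rightarrow>\<^sub>0 'r::comm_ring_1"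
  by (metis diff_self scale_diff_left)

lemmas scale_simps = map_mult_add_right scale_diff scale_uminus scale_scale scale_zero scale_single

text \<open>Additively, the free module on \<open>X\<close> over the group ring is free abelian on
  the pairs of an element of \<open>X\<close> and an exponent, so values on these pairs can be
  prescribed.\<close>

lemma (in comm_group) free_module_additive_extension:
  fixes \<psi> :: "'x \<Rightarrow> 'k \<Rightarrow> 'a"
  assumes \<psi>: "\<And>x k. x \<in> X \<Longrightarrow> \<psi> x k \<in> carrier G"
  obtains \<Psi> :: "('x \<Rightarrow>\<^sub>0 ('k \<Rightarrow>\<^sub>0 int)) \<Rightarrow> 'a" where
    "\<And>f. Poly_Mapping.keys f \<subseteq> X \<Longrightarrow> \<Psi> f \<in> carrier G"
    "\<And>f g. Poly_Mapping.keys f \<subseteq> X \<Longrightarrow> Poly_Mapping.keys g \<subseteq> X \<Longrightarrow> \<Psi> (f + g) = \<Psi> f \<otimes> \<Psi> g"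
    "\<And>f g. Poly_Mapping.keys f \<subseteq> X \<Longrightarrow> Poly_Mapping.keys g \<subseteq> X \<Longrightarrow> \<Psi> (f - g) = \<Psi> f \<otimes> inv \<Psi> g"
    "\<And>x k. x \<in> X \<Longrightarrow> \<Psi> (Poly_Mapping.single x (frag_of k)) = \<psi> x k"
proof -
  let ?S = "X \<times> (UNIV :: 'k set)"
  \<comment> \<open>Uncurrying turns a combination with group ring coefficients into an integer
    combination of pairs.\<close>
  define unc :: "('x \<Rightarrow>\<^sub>0 ('k \<Rightarrow>\<^sub>0 int)) \<Rightarrow> ('x \<times> 'k \<Rightarrow>\<^sub>0 int)" where
    "unc f = Abs_poly_mapping (\<lambda>(x, k). Poly_Mapping.lookup (Poly_Mapping.lookup f x) k)" for f
  have unc: "Poly_Mapping.lookup (unc f) xk = Poly_Mapping.lookup (Poly_Mapping.lookup f (fst xk)) (snd xk)" for f xk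
  proof -
    have "{xk. (\<lambda>(x, k). Poly_Mapping.lookup (Poly_Mapping.lookup f x) k) xk \<noteq> 0} \<subseteq>
        (SIGMA x:Poly_Mapping.keys f. Poly_Mapping.keys (Poly_Mapping.lookup f x))"
      by (auto simp: in_keys_iff)
    then have "finite {xk. (\<lambda>(x, k). Poly_Mapping.lookup (Poly_Mapping.lookup f x) k) xk \<noteq> 0}"
      by (rule finite_subset) auto
    then show ?thesis unfolding unc_def by (simp add: lookup_Abs_poly_mapping split_def)
  qed
  have keys: "Poly_Mapping.keys (unc f) \<subseteq> ?S" if "Poly_Mapping.keys f \<subseteq> X" for f
    using that by (auto simp: subset_iff in_keys_iff unc) (metis lookup_zero)
  have "(\<lambda>(x, k). \<psi> x k) ` ?S \<subseteq> carrier G" using \<psi> by auto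
  then obtain h where h: "h \<in> hom (free_Abelian_group ?S) G" "\<And>xk. xk \<in> ?S \<Longrightarrow> h (frag_of xk) = (\<lambda>(x, k). \<psi> x k) xk"
    using free_Abelian_group_universal by blast
  interpret h: group_hom "free_Abelian_group ?S" G h
    using h(1) by (simp add: group_hom_def group_hom_axioms_def is_group)
  have car: "unc f \<in> carrier (free_Abelian_group ?S)" if "Poly_Mapping.keys f \<subseteq> X" for f
    using keys[OF that] by simp
  have add: "unc (f + g) = unc f + unc g" for f g
    by (rule poly_mapping_eqI) (simp add: unc lookup_add)
  have diff: "unc (f - g) = unc f + - unc g" for f g
    by (rule poly_mapping_eqI) (simp add: unc lookup_add lookup_minus)
  have single: "unc (Poly_Mapping.single x (frag_of k)) = frag_of (x, k)" for x k
    by (rule poly_mapping_eqI) (auto simp: unc lookup_single when_def)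
  show thesis
  proof (rule that[of "h \<circ> unc"])
    fix f g :: "'x \<Rightarrow>\<^sub>0 ('k \<Rightarrow>\<^sub>0 int)"
    assume f: "Poly_Mapping.keys f \<subseteq> X" and g: "Poly_Mapping.keys g \<subseteq> X"
    show "(h \<circ> unc) (f + g) = (h \<circ> unc) f \<otimes> (h \<circ> unc) g"
      using h.hom_mult[OF car[OF f] car[OF g]] by (simp add: add)
    have "h (inv\<^bsub>free_Abelian_group ?S\<^esub> (unc g)) = inv h (unc g)"
      by (rule h.hom_inv[OF car[OF g]])
    then show "(h \<circ> unc) (f - g) = (h \<circ> unc) f \<otimes> inv (h \<circ> unc) g"
      using h.hom_mult[OF car[OF f] h.G.inv_closed[OF car[OF g]]] keys[OF g] by (simp add: diff)
  qed (use h(2) in \<open>simp_all add: single h.hom_closed[OF car]\<close>)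
qed

section \<open>Fox derivatives of words\<close>

text \<open>\<open>frag_of\<close> occurs at two levels: at a component it is a basis exponent
  vector, and at an exponent vector it is a Laurent monomial.\<close>

primrec abel :: "'m arc word \<Rightarrow> 'm \<Rightarrow>\<^sub>0 int" where
  "abel [] = 0"
| "abel (l # w) = (if snd l then frag_of (comp_of (fst l)) else - frag_of (comp_of (fst l))) + abel w"

text \<open>All Fox partial derivatives at once, with abelianized coefficients: the coefficient at
  an arc is the derivative with respect to its generator.\<close>

primrec fox :: "'m arc word \<Rightarrow> 'm arc \<Rightarrow>\<^sub>0 'm laurent" where
  "fox [] = 0"
| "fox (l # w) = (if snd l then Poly_Mapping.single (fst l) 1
     else - Poly_Mapping.single (fst l) (frag_of (- frag_of (comp_of (fst l))))) + frag_of (abel [l]) \<cdot> fox w"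

definition inv_word :: "'a word \<Rightarrow> 'a word" where
  "inv_word w = rev (map (apsnd Not) w)"

lemma inv_word_simps [simp]: "inv_word [] = []" "inv_word (l # w) = inv_word w @ [apsnd Not l]"
  by (simp_all add: inv_word_def)

lemma inv_word_lists: "w \<in> lists (X \<times> UNIV) \<Longrightarrow> inv_word w \<in> lists (X \<times> UNIV)"
  by (induction w) auto

lemma abel_append [simp]: "abel (u @ v) = abel u + abel v"
  by (induction u) (simp_all add: add.assoc)

lemma abel_inv_word [simp]: "abel (inv_word w) = - abel w"
  by (induction w) auto

text \<open>The product rule of the free differential calculus. For \<open>abel u = 0\<close> it is
  plain additivity, which is what happens on the commutator subgroup.\<close>

lemma fox_append: "fox (u @ v) = fox u + frag_of (abel u) \<cdot> fox v"
  by (induction u) (simp_all add: scale_simps scale_one mult_single add.assoc)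

lemma fox_inv_word: "fox (inv_word w) = - (frag_of (- abel w) \<cdot> fox w)"
proof (induction w)
  case (Cons l w)
  have "fox [apsnd Not l] = - (frag_of (- abel [l]) \<cdot> fox [l])"
    by (simp add: scale_simps mult_single)
  then have "fox (inv_word (l # w)) = - (frag_of (- abel w) \<cdot> fox w) + frag_of (- abel w) \<cdot> - (frag_of (- abel [l]) \<cdot> fox [l])"
    by (simp only: inv_word_simps fox_append Cons abel_inv_word)
  also have "\<dots> = - (frag_of (- abel ([l] @ w)) \<cdot> fox ([l] @ w))"
    by (simp only: fox_append abel_append scale_simps mult_single) (simp add: add_ac)
  finally show ?case by simp
qed (simp add: scale_one)

text \<open>The fundamental formula of the Fox calculus, abelianized: each letter contributes the
  difference of the monomials of two successive prefixes, and the sum telescopes.\<close>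

lemma crowell_free_fox: "crowell_free (fox w) = frag_of (abel w) - 1"
proof (induction w)
  case Nil
  show ?case by (simp add: crowell_free_def)
next
  case (Cons l w)
  then show ?case
    by (simp add: crowell_free_add crowell_free_uminus crowell_free_smult crowell_free_single
        right_diff_distrib var_def mult_single)
qed

lemma keys_fox: "w \<in> lists (X \<times> UNIV) \<Longrightarrow> Poly_Mapping.keys (fox w) \<subseteq> X"
proof (induction w)
  case (Cons l w)
  then have "Poly_Mapping.keys (frag_of (abel [l]) \<cdot> fox w) \<subseteq> X"
    using keys_map_mult by (metis Cons_in_lists_iff order_trans)
  then show ?case
    using Cons.prems
    by (auto simp del: abel.simps dest!: subsetD[OF Poly_Mapping.keys_add] subsetD[OF keys_diff] split: if_splits)
qed simp

lemma crossing_relation_in_relations: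
  assumes "c \<in> crossings D"
  shows "crossing_relation D c \<in> alexander_relations D"
  unfolding alexander_relations_def
  by (rule image_eqI[of _ _ "Poly_Mapping.single c 1"])
     (use assms in \<open>auto simp: free_module_def alexander_matrix_map_def scale_one\<close>)

text \<open>The Alexander matrix is the Jacobian of the group presentation. The two underpassing
  arcs lie on one component, so the coefficient of the left arc is -1.\<close>

lemma fox_relator:
  "fox [(over_arc D c, True), (right_arc D c, True), (over_arc D c, False), (left_arc D c, False)]
    = crossing_relation D c"
  by (simp add: scale_simps mult_single crossing_relation_def var_def comp_of_under_arcs
      single_diff algebra_simps)

text \<open>This makes both invariants well defined on the link group. They are treated together
  because in a product the derivative of the right factor is scaled by the monomial of the left
  one.\<close>

lemma word_eq_fox:
  assumes "word_eq (arcs D) (group_relators D) u v"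
  shows "abel u = abel v \<and> fox u - fox v \<in> alexander_relations D"
  using assms
proof induction
  case (refl u)
  show ?case by (simp add: zero_in_relations)
next
  case (sym u v)
  then show ?case using relations_uminus by fastforce
next
  case (trans u v w)
  then show ?case using relations_add by fastforce
next
  case (mult u u' v v')
  have "fox (u @ v) - fox (u' @ v') = (fox u - fox u') + frag_of (abel u) \<cdot> (fox v - fox v')"
    using mult by (simp add: fox_append scale_simps)
  then show ?case using mult.IH by (simp add: relations_add relations_smult)
next
  case (cancel x b)
  show ?case by (cases b) (simp_all add: scale_simps mult_single zero_in_relations)
next
  case (rel r)
  then obtain c where c: "c \<in> crossings D" "r = [(over_arc D c, True), (right_arc D c, True),
           (over_arc D c, False), (left_arc D c, False)]"
    by (auto simp: group_relators_def)
  then show ?case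
    using crossing_relation_in_relations[OF c(1)] fox_relator[of D c]
    by (simp del: fox.simps add: fox.simps(1) comp_of_under_arcs)
qed

section \<open>The link group and its derived subgroups\<close>

lemma (in comm_group) conjugate_eqD:
  assumes "x \<otimes> (y \<otimes> (inv x \<otimes> inv z)) = \<one>" "x \<in> carrier G" "y \<in> carrier G" "z \<in> carrier G"
  shows "y = z"
proof -
  have "x \<otimes> (y \<otimes> (inv x \<otimes> inv z)) = x \<otimes> (inv x \<otimes> (y \<otimes> inv z))"
    using assms by (simp add: m_lcomm)
  also have "\<dots> = y \<otimes> inv z"
    using assms by (simp flip: m_assoc)
  finally have "y \<otimes> inv z = \<one>" using assms(1) by simp
  then have "inv (inv z) = y" using assms by (intro inv_equality) auto
  then show ?thesis using assms by simp
qed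

locale diagram =
  fixes D :: "'m::finite link_diagram"
  assumes diagram: "virtual_link_diagram D"
begin

text \<open>Membership in \<open>W\<close> is to be handled by closure rules and not unfolded into a
  statement about letters.\<close>

declare in_lists_conv_set [simp del] in_listsD [rule del] in_listsI [rule del]

abbreviation "G \<equiv> link_group D"
abbreviation "W \<equiv> lists (arcs D \<times> (UNIV :: bool set))"
abbreviation "G1 \<equiv> derived G (carrier G)"
abbreviation "G2 \<equiv> second_derived G"

definition cls :: "'m arc word \<Rightarrow> 'm arc word set" where
  "cls w = word_rel (arcs D) (group_relators D) `` {w}"

sublocale G: group G
  unfolding link_group_def by (rule group_presented_group)

lemma carrier_G: "carrier G = cls ` W"
  by (auto simp: link_group_def presented_group_def quotient_def cls_def)

lemma cls_mult: "u \<in> W \<Longrightarrow> v \<in> W \<Longrightarrow> cls (u @ v) = cls u \<otimes>\<^bsub>G\<^esub> cls v"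
  by (simp add: link_group_def cls_def presented_group_mult)

lemma cls_Nil: "cls [] = \<one>\<^bsub>G\<^esub>"
  by (simp add: link_group_def cls_def presented_group_def)

lemma cls_closed [simp]: "w \<in> W \<Longrightarrow> cls w \<in> carrier G"
  by (simp add: carrier_G)

lemma cls_eq_iff: "u \<in> W \<Longrightarrow> v \<in> W \<Longrightarrow> cls u = cls v \<longleftrightarrow> word_eq (arcs D) (group_relators D) u v"
  unfolding cls_def by (subst eq_equiv_class_iff[OF equiv_word_rel]) (auto simp: word_rel_def)

lemma cls_inv_word: "w \<in> W \<Longrightarrow> cls (inv_word w) = inv\<^bsub>G\<^esub> (cls w)"
proof (induction w)
  case (Cons l w)
  then have l: "[l] \<in> W" "[apsnd Not l] \<in> W" and w: "w \<in> W" by auto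
  obtain a b where ab: "l = (a, b)" by (cases l)
  have "cls ([apsnd Not l] @ [l]) = cls []"
    using l word_eq.cancel[of a "arcs D" "group_relators D" "\<not> b"] by (subst cls_eq_iff) (auto simp: ab)
  then have "cls [apsnd Not l] = inv\<^bsub>G\<^esub> (cls [l])"
    using l by (intro G.inv_equality[symmetric]) (simp_all add: cls_Nil flip: cls_mult)
  moreover have "cls (inv_word (l # w)) = cls (inv_word w) \<otimes>\<^bsub>G\<^esub> cls [apsnd Not l]"
    using l inv_word_lists[OF w] by (simp add: cls_mult)
  moreover have "cls (l # w) = cls [l] \<otimes>\<^bsub>G\<^esub> cls w"
    using cls_mult[OF l(1) w] by simp
  ultimately show ?case using Cons.IH[OF w] l w by (simp add: G.inv_mult_group)
qed (simp add: cls_Nil)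

lemma W_inv_word: "w \<in> W \<Longrightarrow> inv_word w \<in> W"
  by (rule inv_word_lists)

lemmas cls_simps = cls_mult cls_inv_word cls_Nil append_in_lists_conv W_inv_word

lemma cls_eqD: "u \<in> W \<Longrightarrow> v \<in> W \<Longrightarrow> cls u = cls v \<Longrightarrow> abel u = abel v"
  using word_eq_fox by (metis cls_eq_iff)

section \<open>Commutator subgroup and second derived subgroup\<close>

lemma subgroup_G1: "subgroup G1 G"
  by (rule G.derived_is_subgroup) simp

lemma normal_G1: "G1 \<lhd> G"
  by (rule G.derived_self_is_normal)

lemma normal_G2: "G2 \<lhd> G"
  unfolding second_derived_def by (intro G.derived_is_normal normal_G1)

lemma subgroup_G2: "subgroup G2 G"
  using normal_G2 by (rule normal_imp_subgroup)

lemma derived_subset: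
  assumes H: "H \<subseteq> carrier G" and N: "subgroup N G"
    and comm: "\<And>x y. x \<in> H \<Longrightarrow> y \<in> H \<Longrightarrow> x \<otimes>\<^bsub>G\<^esub> y \<otimes>\<^bsub>G\<^esub> inv\<^bsub>G\<^esub> x \<otimes>\<^bsub>G\<^esub> inv\<^bsub>G\<^esub> y \<in> N"
  shows "derived G H \<subseteq> N"
  unfolding derived_def by (rule G.generate_subgroup_incl[OF _ N]) (use comm in auto)

text \<open>Together with \<open>derived_subset\<close> this bounds a derived subgroup by a property
  of words. The property may depend on the word: a class belongs to the subgroup as soon as one of
  its words qualifies.\<close>

lemma subgroup_cls:
  assumes "P []" "\<And>u v. P u \<Longrightarrow> P v \<Longrightarrow> P (u @ v)" "\<And>w. P w \<Longrightarrow> P (inv_word w)"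
  shows "subgroup (cls ` {w \<in> W. P w}) G"
proof (rule G.subgroupI)
  show "cls ` {w \<in> W. P w} \<noteq> {}" using assms(1) by auto
  fix x assume "x \<in> cls ` {w \<in> W. P w}"
  then obtain u where u: "u \<in> W" "P u" "x = cls u" by auto
  show "inv\<^bsub>G\<^esub> x \<in> cls ` {w \<in> W. P w}"
    using u assms(3) by (intro image_eqI[of _ _ "inv_word u"]) (auto simp: cls_simps)
  fix y assume "y \<in> cls ` {w \<in> W. P w}"
  then obtain v where v: "v \<in> W" "P v" "y = cls v" by auto
  show "x \<otimes>\<^bsub>G\<^esub> y \<in> cls ` {w \<in> W. P w}"
    using u v assms(2) by (intro image_eqI[of _ _ "u @ v"]) (auto simp: cls_simps)
qed auto

lemma cls_commutator:
  assumes "u \<in> W" "v \<in> W"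
  shows "cls u \<otimes>\<^bsub>G\<^esub> cls v \<otimes>\<^bsub>G\<^esub> inv\<^bsub>G\<^esub> cls u \<otimes>\<^bsub>G\<^esub> inv\<^bsub>G\<^esub> cls v = cls (u @ v @ inv_word u @ inv_word v)"
  using assms by (simp add: cls_simps G.m_assoc)

lemma abel_derived:
  assumes "w \<in> W" "cls w \<in> G1"
  shows "abel w = 0"
proof -
  have "G1 \<subseteq> cls ` {w \<in> W. abel w = 0}"
    by (rule derived_subset[OF _ subgroup_cls])
       (auto simp: carrier_G cls_commutator append_in_lists_conv W_inv_word intro!: imageI)
  then obtain v where "v \<in> W" "abel v = 0" "cls w = cls v" using assms(2) by blast
  then show ?thesis using cls_eqD[OF assms(1)] by simp
qed

lemma G1_G2: "G2 \<subseteq> G1"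
  unfolding second_derived_def by (rule derived_subset[OF _ subgroup_G1])
    (use G.derived_in_carrier subgroup_G1 in \<open>auto intro!: subgroup.m_closed subgroup.m_inv_closed\<close>)

text \<open>On words with exponent vector 0 the Fox derivative is additive, so it vanishes on their
  commutators. Passing to another word for the same class changes it only by a relation.\<close>

lemma fox_second_derived:
  assumes "w \<in> W" "cls w \<in> G2"
  shows "fox w \<in> alexander_relations D"
proof -
  let ?P = "\<lambda>w. abel w = 0 \<and> fox w \<in> alexander_relations D"
  have "G2 \<subseteq> cls ` {w \<in> W. ?P w}"
    unfolding second_derived_def
  proof (rule derived_subset[OF _ subgroup_cls])
    have rep: "\<exists>w. w \<in> W \<and> x = cls w \<and> abel w = 0" if "x \<in> G1" for x
      using subgroup.mem_carrier[OF subgroup_G1 that] that abel_derived by (auto simp: carrier_G)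
    fix x y assume "x \<in> G1" "y \<in> G1"
    then obtain u v where u: "u \<in> W" "x = cls u" "abel u = 0" and v: "v \<in> W" "y = cls v" "abel v = 0"
      using rep by metis
    have "?P (u @ v @ inv_word u @ inv_word v)"
      using u v by (simp add: fox_append fox_inv_word scale_one zero_in_relations)
    then show "x \<otimes>\<^bsub>G\<^esub> y \<otimes>\<^bsub>G\<^esub> inv\<^bsub>G\<^esub> x \<otimes>\<^bsub>G\<^esub> inv\<^bsub>G\<^esub> y \<in> cls ` {w \<in> W. ?P w}"
      using u v by (auto simp: cls_commutator append_in_lists_conv W_inv_word)
  qed (auto simp: zero_in_relations fox_append fox_inv_word scale_one relations_add relations_uminus
        intro: G.derived_in_carrier[THEN subsetD])
  then obtain v where v: "v \<in> W" "cls w = cls v" "fox v \<in> alexander_relations D" "abel v = 0"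
    using assms(2) by auto
  then have "fox w - fox v \<in> alexander_relations D"
    using word_eq_fox assms(1) by (metis cls_eq_iff)
  from relations_add[OF this v(3)] show ?thesis by simp
qed

lemma relator:
  assumes "c \<in> crossings D"
  shows "[(over_arc D c, True), (right_arc D c, True), (over_arc D c, False), (left_arc D c, False)] \<in> W"
    "cls [(over_arc D c, True), (right_arc D c, True), (over_arc D c, False), (left_arc D c, False)] = cls []"
proof -
  show *: "[(over_arc D c, True), (right_arc D c, True), (over_arc D c, False), (left_arc D c, False)] \<in> W"
    using over_arc_in_arcs[OF diagram assms] crossing_arcs_in_arcs[OF diagram assms] by auto
  show "cls [(over_arc D c, True), (right_arc D c, True), (over_arc D c, False), (left_arc D c, False)] = cls []"
    using assms * by (subst cls_eq_iff) (auto simp: group_relators_def intro!: word_eq.rel)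
qed

text \<open>In the abelian group \<open>G Mod G1\<close> the crossing relations identify the
  generators along each circle, so the class of a word there depends only on its exponent
  vector.\<close>

lemma derived_abel:
  assumes "w \<in> W" "abel w = 0"
  shows "cls w \<in> G1"
proof -
  interpret Q: comm_group "G Mod G1" by (rule G.derived_quot_is_comm_group)
  interpret N: normal G1 G by (rule normal_G1)
  interpret q: group_hom G "G Mod G1" "\<lambda>x. G1 #>\<^bsub>G\<^esub> x"
    by (simp add: group_hom_def group_hom_axioms_def G.is_group Q.is_group N.r_coset_hom_Mod)
  define q where "q w = G1 #>\<^bsub>G\<^esub> cls w" for w
  have q_closed: "q w \<in> carrier (G Mod G1)" if "w \<in> W" for w
    unfolding q_def using that by (intro q.hom_closed) simp
  have q_mult: "q (u @ v) = q u \<otimes>\<^bsub>G Mod G1\<^esub> q v" if "u \<in> W" "v \<in> W" for u v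
    unfolding q_def using that by (subst q.hom_mult[symmetric]) (simp_all add: cls_mult)
  have q_inv: "q (inv_word u) = inv\<^bsub>G Mod G1\<^esub> q u" if "u \<in> W" for u
    unfolding q_def using that by (subst q.hom_inv[symmetric]) (simp_all add: cls_inv_word)
  have q_const: "q [(a, True)] = q [(a', True)]" if a: "a \<in> arcs D" "a' \<in> arcs D" "comp_of a = comp_of a'" for a a'
  proof (rule arc_invariant_const[OF diagram a])
    fix c assume c: "c \<in> crossings D"
    let ?o = "[(over_arc D c, True)]" and ?r = "[(right_arc D c, True)]" and ?l = "[(left_arc D c, True)]"
    have W: "?o \<in> W" "?r \<in> W" "?l \<in> W"
      using over_arc_in_arcs[OF diagram c] crossing_arcs_in_arcs[OF diagram c] by auto
    have "q (?o @ ?r @ inv_word ?o @ inv_word ?l) = \<one>\<^bsub>G Mod G1\<^esub>"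
      using relator(2)[OF c] q.hom_one by (simp add: q_def cls_Nil)
    then have "q ?o \<otimes>\<^bsub>G Mod G1\<^esub> (q ?r \<otimes>\<^bsub>G Mod G1\<^esub> (inv\<^bsub>G Mod G1\<^esub> q ?o \<otimes>\<^bsub>G Mod G1\<^esub> inv\<^bsub>G Mod G1\<^esub> q ?l)) = \<one>\<^bsub>G Mod G1\<^esub>"
      using W by (simp only: q_mult q_inv append_in_lists_conv W_inv_word simp_thms)
    then show "q ?r = q ?l"
      by (rule Q.conjugate_eqD) (use W in \<open>simp_all add: q_closed\<close>)
  qed
  define \<alpha> where "\<alpha> i = (i, SOME S. (i, S) \<in> arcs D)" for i
  have \<alpha>: "\<alpha> i \<in> arcs D" for i
    unfolding \<alpha>_def using arc_exists[OF diagram, of i] by (metis someI_ex)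
  have comp_\<alpha>: "comp_of (\<alpha> i) = i" for i by (simp add: \<alpha>_def comp_of_def)
  have "range (\<lambda>i. q [(\<alpha> i, True)]) \<subseteq> carrier (G Mod G1)"
    using q_closed \<alpha> by auto
  \<comment> \<open>One arc is chosen on each component; \<theta> sends the basis vector of the
    component to the class of that arc.\<close>
  then obtain \<theta> where \<theta>: "\<theta> \<in> hom (free_Abelian_group UNIV) (G Mod G1)"
      "\<And>i. i \<in> UNIV \<Longrightarrow> \<theta> (frag_of i) = q [(\<alpha> i, True)]"
    by (rule Q.free_Abelian_group_universal) blast
  interpret \<theta>: group_hom "free_Abelian_group UNIV" "G Mod G1" \<theta>
    using \<theta>(1) by (simp add: group_hom_def group_hom_axioms_def Q.is_group)
  have \<theta>_add: "\<theta> (x + y) = \<theta> x \<otimes>\<^bsub>G Mod G1\<^esub> \<theta> y" for x y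
    using \<theta>.hom_mult[of x y] by simp
  have \<theta>_minus: "\<theta> (- x) = inv\<^bsub>G Mod G1\<^esub> (\<theta> x)" for x
    using \<theta>.hom_inv[of x] by simp
  have letter: "q [l] = \<theta> (abel [l])" if l: "[l] \<in> W" for l
  proof (cases l)
    case (Pair a b)
    then have a: "a \<in> arcs D" using l by auto
    have T: "q [(a, True)] = \<theta> (frag_of (comp_of a))"
      unfolding \<theta>(2)[OF UNIV_I] by (rule q_const) (use a \<alpha> comp_\<alpha> in auto)
    moreover have "q [(a, False)] = inv\<^bsub>G Mod G1\<^esub> (q [(a, True)])"
      using q_inv[of "[(a, True)]"] a by simp
    ultimately show ?thesis by (cases b) (simp_all add: Pair \<theta>_minus)
  qed
  have "q w = \<theta> (abel w)" using assms(1)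
  proof (induction w)
    case Nil
    show ?case using \<theta>.hom_one q.hom_one by (simp add: q_def cls_Nil)
  next
    case (Cons l w)
    then have "[l] \<in> W" "w \<in> W" by auto
    then have "q ([l] @ w) = \<theta> (abel ([l] @ w))"
      using Cons.IH letter[of l] by (simp only: q_mult abel_append \<theta>_add)
    then show ?case by simp
  qed
  then have "G1 #>\<^bsub>G\<^esub> cls w = G1"
    using \<theta>.hom_one assms(2) by (simp add: q_def)
  from G.coset_join1[OF this _ subgroup_G1] show ?thesis using assms(1) by simp
qed

text \<open>A Schreier transversal without any prefix condition. With \<open>s 0 = []\<close>, the
  loop at 0 along a word in the commutator subgroup is the word itself, and the monomial 1 is
  represented by a word with derivative 0.\<close>

lemma section_exists:
  obtains s where "\<And>t. s t \<in> W" "\<And>t. abel (s t) = t" "s 0 = []"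
proof -
  have "\<exists>w. w \<in> W \<and> abel w = t" for t
  proof (rule frag_induction[OF subset_UNIV, of _ t])
    show "\<exists>w. w \<in> W \<and> abel w = 0" by (intro exI[of _ "[]"]) simp
    show "\<exists>w. w \<in> W \<and> abel w = frag_of i" for i
    proof -
      obtain S where "(i, S) \<in> arcs D" using arc_exists[OF diagram] .
      then show ?thesis by (intro exI[of _ "[((i, S), True)]"]) (simp add: comp_of_def)
    qed
    show "\<exists>w. w \<in> W \<and> abel w = x - y" if x: "\<exists>w. w \<in> W \<and> abel w = x" and y: "\<exists>w. w \<in> W \<and> abel w = y" for x y
    proof -
      obtain u where "u \<in> W" "abel u = x" using x by blast
      moreover obtain v where "v \<in> W" "abel v = y" using y by blast
      ultimately show ?thesis by (intro exI[of _ "u @ inv_word v"]) (simp add: W_inv_word)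
    qed
  qed
  then obtain s where s: "\<And>t. s t \<in> W \<and> abel (s t) = t" by metis
  show thesis
    by (rule that[of "s(0 := [])"]) (use s in auto)
qed

section \<open>Fox derivatives detect the second derived subgroup\<close>

text \<open>
  Reidemeister-Schreier rewriting: for a section \<open>s\<close> of the abelianization, the additive map \<open>\<Psi>\<close> sends
  the multiple of an arc \<open>a\<close> by the monomial with exponent \<open>u\<close> to the class of the loop
  \<open>s u, a, (s (u + abel a))\<inverse>\<close> in \<open>G1 / G2\<close>. It kills the relations of the Alexander module, and it
  sends the Fox derivative of a word in \<open>G1\<close> to the class of that word.
\<close>

lemma second_derived_fox:
  assumes w: "w \<in> W" and rel: "fox w \<in> alexander_relations D"
  shows "cls w \<in> G2"
proof -
  \<comment> \<open>The Crowell map kills relations and sends \<open>fox w\<close> to the monomial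
    of \<open>abel w\<close> minus 1.\<close>
  have "abel w = 0"
  proof -
    have "frag_of (abel w) - 1 = (0 :: 'm laurent)"
      using crowell_free_relations[OF rel] by (simp add: crowell_free_fox)
    then have "frag_of (abel w) = (frag_of 0 :: 'm laurent)" by simp
    then show ?thesis unfolding frag_of_eq .
  qed
  obtain s where s: "\<And>t. s t \<in> W" "\<And>t. abel (s t) = t" "s 0 = []"
    using section_exists by blast
  let ?H = "G\<lparr>carrier := G1\<rparr>"
  let ?A = "?H Mod G2"
  interpret H: group ?H by (rule G.subgroup_imp_group[OF subgroup_G1])
  have "derived ?H (carrier ?H) = G2"
    using G.derived_consistent[OF subset_refl subgroup_G1] by (simp add: second_derived_def)
  then interpret A: comm_group ?A using H.derived_quot_is_comm_group by simp
  interpret N: normal G2 G by (rule normal_G2)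
  define q where "q w = G2 #>\<^bsub>G\<^esub> cls w" for w
  have q_closed: "q w \<in> carrier ?A" if "w \<in> W" "abel w = 0" for w
    using derived_abel[OF that] by (auto simp: carrier_FactGroup q_def r_coset_def)
  \<comment> \<open>The product of \<open>?A\<close> is the coset product of \<open>G\<close>, so it
    makes sense for the cosets of all words.\<close>
  have q_mult: "q (u @ v) = q u \<otimes>\<^bsub>?A\<^esub> q v" if "u \<in> W" "v \<in> W" for u v
    using that by (simp add: q_def cls_mult N.rcos_sum set_mult_def flip: N.rcos_sum)
  have q_Nil: "q [] = \<one>\<^bsub>?A\<^esub>"
    by (simp add: q_def cls_Nil G.coset_mult_one N.subset)
  define loop where "loop u v = s u @ v @ inv_word (s (u + abel v))" for u v
  have loop_W: "loop u v \<in> W" if "v \<in> W" for u v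
    using that s by (simp add: loop_def W_inv_word)
  have abel_loop: "abel (loop u v) = 0" for u v
    using s by (simp add: loop_def)
  have loop_cong: "q (loop u v) = q (loop u v')" if "v \<in> W" "v' \<in> W" "cls v = cls v'" for u v v'
    using that s cls_eqD[OF that] by (simp add: q_def loop_def cls_simps)
  have loop_Nil: "q (loop u []) = \<one>\<^bsub>?A\<^esub>" for u
    using s q_Nil by (simp add: q_def loop_def cls_simps)
  have loop_append: "q (loop u (v @ w)) = q (loop u v) \<otimes>\<^bsub>?A\<^esub> q (loop (u + abel v) w)"
    if "v \<in> W" "w \<in> W" for u v w
  proof -
    \<comment> \<open>The path back from the vertex \<open>u + abel v\<close> cancels against the
      path leading there.\<close>
    have "cls (loop u (v @ w)) = cls (loop u v @ loop (u + abel v) w)"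
      using that s by (simp add: loop_def cls_simps G.m_assoc add.assoc G.inv_solve_left)
    then have "q (loop u (v @ w)) = q (loop u v @ loop (u + abel v) w)" by (simp add: q_def)
    then show ?thesis by (simp only: q_mult loop_W that)
  qed
  obtain \<Psi> where \<Psi>: "\<And>f. Poly_Mapping.keys f \<subseteq> arcs D \<Longrightarrow> \<Psi> f \<in> carrier ?A"
    "\<And>f g. Poly_Mapping.keys f \<subseteq> arcs D \<Longrightarrow> Poly_Mapping.keys g \<subseteq> arcs D \<Longrightarrow> \<Psi> (f + g) = \<Psi> f \<otimes>\<^bsub>?A\<^esub> \<Psi> g"
    "\<And>f g. Poly_Mapping.keys f \<subseteq> arcs D \<Longrightarrow> Poly_Mapping.keys g \<subseteq> arcs D \<Longrightarrow> \<Psi> (f - g) = \<Psi> f \<otimes>\<^bsub>?A\<^esub> inv\<^bsub>?A\<^esub> \<Psi> g"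
    "\<And>a u. a \<in> arcs D \<Longrightarrow> \<Psi> (Poly_Mapping.single a (frag_of u)) = q (loop u [(a, True)])"
    by (rule A.free_module_additive_extension[of "arcs D" "\<lambda>a u. q (loop u [(a, True)])"])
       (use q_closed loop_W abel_loop in auto)
  have \<Psi>_0: "\<Psi> 0 = \<one>\<^bsub>?A\<^esub>"
    using \<Psi>(1)[of 0] \<Psi>(3)[of 0 0] by (simp add: A.r_inv del: one_FactGroup mult_FactGroup)
  have letter: "\<Psi> (frag_of u \<cdot> fox [l]) = q (loop u [l])" if l: "[l] \<in> W" for u l
  proof (cases l)
    case (Pair a b)
    then have a: "a \<in> arcs D" using l by auto
    show ?thesis
    proof (cases b)
      case True
      then show ?thesis using \<Psi>(4)[OF a] by (simp add: Pair scale_simps mult_single)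
    next
      case False
      let ?e = "frag_of (comp_of a)"
      \<comment> \<open>An inverse letter read from \<open>u\<close> runs backwards along the edge
        that starts at \<open>u - ?e\<close>.\<close>
      let ?x = "loop (u - ?e) [(a, True)]" and ?y = "loop u [(a, False)]"
      have "cls ([(a, True)] @ [(a, False)]) = cls []"
        using a word_eq.cancel[of a "arcs D" "group_relators D" True] by (subst cls_eq_iff) auto
      then have "q ?x \<otimes>\<^bsub>?A\<^esub> q ?y = \<one>\<^bsub>?A\<^esub>"
        using a loop_append[of "[(a, True)]" "[(a, False)]" "u - ?e"]
          loop_cong[of "[(a, True)] @ [(a, False)]" "[]" "u - ?e"] loop_Nil by simp
      moreover have "q ?x \<in> carrier ?A" "q ?y \<in> carrier ?A"
        using a by (auto intro!: q_closed loop_W abel_loop)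
      ultimately have "q ?y = inv\<^bsub>?A\<^esub> q ?x"
        by (metis A.inv_equality A.m_comm)
      moreover have "frag_of u \<cdot> fox [l] = 0 - Poly_Mapping.single a (frag_of (u - ?e))"
        by (simp add: Pair False scale_simps mult_single)
      ultimately show ?thesis
        using a \<Psi>(3)[of 0 "Poly_Mapping.single a (frag_of (u - ?e))"] \<Psi>(1)[of "Poly_Mapping.single a (frag_of (u - ?e))"]
          \<Psi>(4)[OF a] \<Psi>_0
        by (simp add: Pair False del: one_FactGroup mult_FactGroup)
    qed
  qed
  have keys: "Poly_Mapping.keys (r \<cdot> fox v) \<subseteq> arcs D" if "v \<in> W" for v r
    using keys_map_mult keys_fox[OF that] by (rule order_trans)
  \<comment> \<open>The rest of a word is read from the vertex reached by its first letter, so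
    \<open>u\<close> varies in the induction.\<close>
  have \<Psi>_fox: "\<Psi> (frag_of u \<cdot> fox v) = q (loop u v)" if "v \<in> W" for u v
    using that
  proof (induction v arbitrary: u)
    case Nil
    then show ?case using loop_Nil \<Psi>_0 by (simp add: scale_simps)
  next
    case (Cons l v)
    then have l: "[l] \<in> W" and v: "v \<in> W" by auto
    have "frag_of u \<cdot> fox ([l] @ v) = frag_of u \<cdot> fox [l] + frag_of (u + abel [l]) \<cdot> fox v"
      by (simp only: fox_append scale_simps mult_single mult_1)
    then have "\<Psi> (frag_of u \<cdot> fox ([l] @ v)) = q (loop u [l]) \<otimes>\<^bsub>?A\<^esub> q (loop (u + abel [l]) v)"
      using \<Psi>(2)[OF keys[OF l] keys[OF v]] Cons.IH letter[OF l] by metis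
    also have "\<dots> = q (loop u ([l] @ v))" using loop_append[OF l v] by metis
    finally show ?case by simp
  qed
  \<comment> \<open>A monomial multiple of a crossing relation is the derivative of a relator read
    from some vertex. That loop is trivial because the relator is; other coefficients follow by
    additivity.\<close>
  have \<Psi>_rel: "\<Psi> (p \<cdot> crossing_relation D c) = \<one>\<^bsub>?A\<^esub>" if c: "c \<in> crossings D" for p c
  proof (rule frag_induction[OF subset_UNIV, of _ p])
    let ?r = "[(over_arc D c, True), (right_arc D c, True), (over_arc D c, False), (left_arc D c, False)]"
    show "\<Psi> (0 \<cdot> crossing_relation D c) = \<one>\<^bsub>?A\<^esub>"
      using \<Psi>_0 by (simp only: scale_zero_left)
    show "\<Psi> (frag_of u \<cdot> crossing_relation D c) = \<one>\<^bsub>?A\<^esub>" for u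
      unfolding fox_relator[symmetric] using \<Psi>_fox[OF relator(1)[OF c]] loop_cong[OF relator(1)[OF c] _ relator(2)[OF c]] loop_Nil
      by simp
    have k: "Poly_Mapping.keys (r \<cdot> crossing_relation D c) \<subseteq> arcs D" for r
      unfolding fox_relator[symmetric] by (rule keys[OF relator(1)[OF c]])
    show "\<Psi> ((a - b) \<cdot> crossing_relation D c) = \<one>\<^bsub>?A\<^esub>"
      if "\<Psi> (a \<cdot> crossing_relation D c) = \<one>\<^bsub>?A\<^esub>" "\<Psi> (b \<cdot> crossing_relation D c) = \<one>\<^bsub>?A\<^esub>" for a b
      unfolding scale_diff_left \<Psi>(3)[OF k k] that by (simp only: A.inv_one A.r_one A.one_closed)
  qed
  have "\<Psi> r = \<one>\<^bsub>?A\<^esub>" if "r \<in> alexander_relations D" for r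
  proof -
    obtain F where F: "Poly_Mapping.keys F \<subseteq> crossings D" "r = alexander_matrix_map D F"
      using \<open>r \<in> _\<close> by (auto simp: alexander_relations_def free_module_def)
    \<comment> \<open>The bound on the support is carried along since \<Psi> is known to be additive
      only on combinations of arcs.\<close>
    have "Poly_Mapping.keys (\<Sum>c\<in>C. Poly_Mapping.lookup F c \<cdot> crossing_relation D c) \<subseteq> arcs D \<and>
        \<Psi> (\<Sum>c\<in>C. Poly_Mapping.lookup F c \<cdot> crossing_relation D c) = \<one>\<^bsub>?A\<^esub>"
      if "finite C" "C \<subseteq> crossings D" for C
      using that
    proof induction
      case empty
      then show ?case using \<Psi>_0 by simp
    next
      case (insert c C)
      then have c: "c \<in> crossings D" by simp
      have k: "Poly_Mapping.keys (Poly_Mapping.lookup F c \<cdot> crossing_relation D c) \<subseteq> arcs D"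
        unfolding fox_relator[symmetric] by (rule keys[OF relator(1)[OF c]])
      have IH: "Poly_Mapping.keys (\<Sum>c\<in>C. Poly_Mapping.lookup F c \<cdot> crossing_relation D c) \<subseteq> arcs D"
        "\<Psi> (\<Sum>c\<in>C. Poly_Mapping.lookup F c \<cdot> crossing_relation D c) = \<one>\<^bsub>?A\<^esub>"
        using insert by auto
      show ?case
        unfolding sum.insert[OF insert.hyps] \<Psi>(2)[OF k IH(1)] \<Psi>_rel[OF c] IH(2)
        using order_trans[OF Poly_Mapping.keys_add Un_least[OF k IH(1)]]
        by (simp only: A.r_one A.one_closed simp_thms)
    qed
    then show ?thesis using F by (simp add: alexander_matrix_map_def)
  qed
  from this[OF rel] have "q (loop 0 w) = \<one>\<^bsub>?A\<^esub>"
    using \<Psi>_fox[OF w, of 0] by (simp add: scale_one)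
  then have "G2 #>\<^bsub>G\<^esub> cls w = G2"
    using \<open>abel w = 0\<close> s(3) by (simp add: loop_def q_def)
  from G.coset_join1[OF this _ subgroup_G2] show ?thesis using w by simp
qed

text \<open>Both conditions force equal exponent vectors, and then the Fox derivative of
  \<open>v @ inv_word w\<close> is the difference of the two derivatives.\<close>

lemma cosets_eq_iff:
  assumes v: "v \<in> W" and w: "w \<in> W"
  shows "G2 #>\<^bsub>G\<^esub> cls v = G2 #>\<^bsub>G\<^esub> cls w \<longleftrightarrow> fox v - fox w \<in> alexander_relations D"
proof -
  interpret N: normal G2 G by (rule normal_G2)
  have vw: "v @ inv_word w \<in> W" using v w by (simp add: W_inv_word)
  have vw': "cls (v @ inv_word w) = cls v \<otimes>\<^bsub>G\<^esub> inv\<^bsub>G\<^esub> cls w"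
    using v w by (simp add: cls_simps)
  have "G2 #>\<^bsub>G\<^esub> cls v = G2 #>\<^bsub>G\<^esub> cls w \<longleftrightarrow> cls (v @ inv_word w) \<in> G2"
  proof
    assume "G2 #>\<^bsub>G\<^esub> cls v = G2 #>\<^bsub>G\<^esub> cls w"
    from G.coset_mult_inv2[OF this] have "G2 #>\<^bsub>G\<^esub> cls (v @ inv_word w) = G2"
      using v w N.subset by (simp add: vw')
    from G.coset_join1[OF this _ subgroup_G2] show "cls (v @ inv_word w) \<in> G2"
      using vw by simp
  next
    assume "cls (v @ inv_word w) \<in> G2"
    then have "G2 #>\<^bsub>G\<^esub> (cls v \<otimes>\<^bsub>G\<^esub> inv\<^bsub>G\<^esub> cls w) = G2"
      using G.coset_join2[OF _ subgroup_G2] vw by (simp add: vw'[symmetric])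
    from G.coset_mult_inv1[OF this] show "G2 #>\<^bsub>G\<^esub> cls v = G2 #>\<^bsub>G\<^esub> cls w"
      using v w N.subset by simp
  qed
  also have "\<dots> \<longleftrightarrow> fox v - fox w \<in> alexander_relations D"
  proof
    assume A: "cls (v @ inv_word w) \<in> G2"
    then have "abel (v @ inv_word w) = 0" using abel_derived[OF vw] G1_G2 by blast
    then have "fox (v @ inv_word w) = fox v - fox w" by (simp add: fox_append fox_inv_word scale_simps mult_single scale_one)
    then show "fox v - fox w \<in> alexander_relations D" using fox_second_derived[OF vw A] by simp
  next
    assume A: "fox v - fox w \<in> alexander_relations D"
    have "crowell_free (fox v - fox w) = frag_of (abel v) - frag_of (abel w)"
      unfolding diff_conv_add_uminus crowell_free_add crowell_free_uminus crowell_free_fox by simp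
    then have "abel v = abel w" using crowell_free_relations[OF A] by (simp add: frag_of_eq)
    then have "fox (v @ inv_word w) = fox v - fox w" by (simp add: fox_append fox_inv_word scale_simps mult_single scale_one)
    then show "cls (v @ inv_word w) \<in> G2" using second_derived_fox[OF vw] A by simp
  qed
  finally show ?thesis .
qed

section \<open>The isomorphism and the fundamental quandles\<close>

text \<open>
  With an additive map \<open>\<sigma>\<close> sending each monomial to the Fox derivative of a word that represents it, every
  element \<open>f\<close> of the free module differs from \<open>\<sigma> (crowell_free f)\<close> by the Fox derivative of a
  word in \<open>G1\<close>.
\<close>

lemma fox_surj:
  assumes f: "Poly_Mapping.keys f \<subseteq> arcs D" and unit: "crowell_free f + 1 dvd 1"
  obtains w where "w \<in> W" "fox w = f"
proof -
  obtain s where s: "\<And>t. s t \<in> W" "\<And>t. abel (s t) = t" "s 0 = []"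
    using section_exists by blast
  \<comment> \<open>The additive group of the module elements, packaged as a monoid record so that
    the universal property of free abelian groups yields \<sigma>.\<close>
  let ?A = "\<lparr>carrier = UNIV, monoid.mult = (+), one = 0\<rparr> :: ('m arc \<Rightarrow>\<^sub>0 'm laurent) monoid"
  interpret A: comm_group ?A
  proof (rule comm_groupI)
    show "\<exists>y\<in>carrier ?A. y \<otimes>\<^bsub>?A\<^esub> x = \<one>\<^bsub>?A\<^esub>" for x
      by (rule bexI[of _ "- x"]) simp_all
  qed (simp_all add: add_ac)
  have "range (\<lambda>t. fox (s t)) \<subseteq> carrier ?A" by simp
  then obtain \<sigma> where \<sigma>: "\<sigma> \<in> hom (free_Abelian_group UNIV) ?A"
      "\<And>t. t \<in> UNIV \<Longrightarrow> \<sigma> (frag_of t) = fox (s t)"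
    by (rule A.free_Abelian_group_universal) blast
  have add: "\<sigma> (x + y) = \<sigma> x + \<sigma> y" for x y
    using \<sigma>(1) by (simp add: hom_def)
  have diff: "\<sigma> (x - y) = \<sigma> x - \<sigma> y" for x y
    using add[of "x - y" y] by simp
  have zero: "\<sigma> 0 = 0" using diff[of 0 0] by simp
  define Q where "Q f \<longleftrightarrow> (\<exists>h. h \<in> W \<and> abel h = 0 \<and> f = fox h + \<sigma> (crowell_free f))" for f
  have Q0: "Q 0"
    unfolding Q_def using zero by (intro exI[of _ "[]"]) (simp add: crowell_free_def)
  have Q_diff: "Q (f - g)" if Q: "Q f" "Q g" for f g
  proof -
    obtain h where h: "h \<in> W" "abel h = 0" "f = fox h + \<sigma> (crowell_free f)"
      using Q(1) unfolding Q_def by blast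
    obtain k where k: "k \<in> W" "abel k = 0" "g = fox k + \<sigma> (crowell_free g)"
      using Q(2) unfolding Q_def by blast
    have c: "crowell_free (f - g) = crowell_free f - crowell_free g"
      unfolding diff_conv_add_uminus crowell_free_add crowell_free_uminus ..
    have "fox (h @ inv_word k) = fox h - fox k"
      using h(2) k(2) by (simp add: fox_append fox_inv_word scale_one)
    then have "f - g = fox (h @ inv_word k) + \<sigma> (crowell_free (f - g))"
      unfolding c diff by (subst h(3), subst k(3)) (simp add: algebra_simps)
    then show ?thesis unfolding Q_def using h k by (intro exI[of _ "h @ inv_word k"]) (simp add: W_inv_word)
  qed
  have Q_single: "Q (Poly_Mapping.single a p)" if a: "a \<in> arcs D" for a p
  proof (rule frag_induction[OF subset_UNIV, of _ p])
    fix u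
    let ?e = "frag_of (comp_of a)"
    \<comment> \<open>The Schreier loop of the edge \<open>a\<close> at \<open>u\<close>: its
      derivative is the monomial multiple of \<open>a\<close>, corrected by the derivatives of the
      two representatives.\<close>
    let ?h = "s u @ [(a, True)] @ inv_word (s (u + ?e))"
    have "crowell_free (Poly_Mapping.single a (frag_of u)) = frag_of (u + ?e) - frag_of u"
      by (simp add: crowell_free_single var_def right_diff_distrib mult_single)
    then have "\<sigma> (crowell_free (Poly_Mapping.single a (frag_of u))) = fox (s (u + ?e)) - fox (s u)"
      by (simp add: diff \<sigma>(2))
    moreover have "fox ?h = fox (s u) + Poly_Mapping.single a (frag_of u) - fox (s (u + ?e))"
      by (simp add: fox_append fox_inv_word s(2) scale_simps mult_single scale_one)
    ultimately show "Q (Poly_Mapping.single a (frag_of u))"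
      unfolding Q_def using s(1,2) a by (intro exI[of _ ?h]) (simp add: W_inv_word)
  qed (use Q0 Q_diff in \<open>simp_all add: single_diff\<close>)
  have Q_add: "Q (f + g)" if "Q f" "Q g" for f g
    using Q_diff[OF that(1) Q_diff[OF Q0 that(2)]] by simp
  have "Q (\<Sum>a\<in>A. Poly_Mapping.single a (Poly_Mapping.lookup f a))" if "finite A" "A \<subseteq> arcs D" for A
    using that by induction (simp_all add: Q0 Q_add Q_single)
  from this[OF finite_keys f] have "Q f" by (simp only: poly_mapping_sum_single)
  then obtain h where h: "h \<in> W" "abel h = 0" "f = fox h + \<sigma> (crowell_free f)"
    unfolding Q_def by blast
  \<comment> \<open>The unit is a monomial, and \<open>s 0 = []\<close> contributes nothing, so
    \<sigma> yields the derivative of the single word \<open>s e\<close>. Since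
    \<open>abel h = 0\<close>, concatenating \<open>h\<close> with it adds the derivatives.\<close>
  obtain e where "crowell_free f + 1 = frag_of e" using unit_crowell_free[OF unit] .
  then have "crowell_free f = frag_of e - frag_of 0" by (simp add: eq_diff_eq)
  then have "\<sigma> (crowell_free f) = fox (s e)"
    using s(3) by (simp only: diff \<sigma>(2) UNIV_I) simp
  then have "fox (h @ s e) = f" using h by (simp add: fox_append scale_one)
  then show thesis using h(1) s(1) by (intro that[of "h @ s e"]) simp_all
qed

section \<open>The isomorphism on the total quandle\<close>

lemma carrier_total:
  "carrier (total_alexander_quandle D) = (\<lambda>w. alexander_proj D (fox w)) ` W"
proof (intro equalityI subsetI)
  fix x assume "x \<in> carrier (total_alexander_quandle D)"
  then obtain f where f: "Poly_Mapping.keys f \<subseteq> arcs D" "crowell_free f + 1 dvd 1" "x = alexander_proj D f"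
    by (auto simp: total_alexander_quandle_def carrier_alexander_module crowell_map_proj)
  obtain w where "w \<in> W" "fox w = f" using fox_surj[OF f(1,2)] .
  then show "x \<in> (\<lambda>w. alexander_proj D (fox w)) ` W" using f(3) by blast
next
  fix x assume "x \<in> (\<lambda>w. alexander_proj D (fox w)) ` W"
  then obtain w where w: "w \<in> W" "x = alexander_proj D (fox w)" by auto
  have "(1 :: 'm laurent) = frag_of (abel w) * frag_of (- abel w)" by (simp add: mult_single)
  then have "(frag_of (abel w) :: 'm laurent) dvd 1" by (rule dvdI)
  then show "x \<in> carrier (total_alexander_quandle D)"
    using w keys_fox[OF w(1)] by (auto simp: total_alexander_quandle_def carrier_alexander_module crowell_map_proj crowell_free_fox)
qed

lemma total_op_fox:
  assumes "v \<in> W" "w \<in> W"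
  shows "alexander_proj D (fox v) \<triangleright>\<^bsub>total_alexander_quandle D\<^esub> alexander_proj D (fox w)
    = alexander_proj D (fox (w @ v @ inv_word w))"
proof -
  have "fox (w @ v @ inv_word w) = (crowell_free (fox w) + 1) \<cdot> fox v - crowell_free (fox v) \<cdot> fox w"
    by (simp add: fox_append fox_inv_word crowell_free_fox scale_simps mult_single scale_diff_left scale_one)
  then show ?thesis using total_alexander_op[OF diagram keys_fox[OF assms(2)]] by simp
qed

definition coset :: "'m arc word \<Rightarrow> 'm arc word set set" where
  "coset w = G2 #>\<^bsub>G\<^esub> cls w"

lemma carrier_Conj: "carrier (Conj (metabelian_quotient G)) = coset ` W"
  by (auto simp: Conj_def metabelian_quotient_def carrier_FactGroup carrier_G coset_def)

lemma Conj_op_coset: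
  assumes "v \<in> W" "w \<in> W"
  shows "coset v \<triangleright>\<^bsub>Conj (metabelian_quotient G)\<^esub> coset w = coset (w @ v @ inv_word w)"
proof -
  interpret N: normal G2 G by (rule normal_G2)
  interpret M: group "G Mod G2" by (rule N.factorgroup_is_group)
  interpret q: group_hom G "G Mod G2" "\<lambda>x. G2 #>\<^bsub>G\<^esub> x"
    by (simp add: group_hom_def group_hom_axioms_def G.is_group M.is_group N.r_coset_hom_Mod)
  have "coset v \<triangleright>\<^bsub>Conj (metabelian_quotient G)\<^esub> coset w
      = coset w \<otimes>\<^bsub>G Mod G2\<^esub> coset v \<otimes>\<^bsub>G Mod G2\<^esub> inv\<^bsub>G Mod G2\<^esub> coset w"
    by (simp add: Conj_def metabelian_quotient_def)
  also have "\<dots> = G2 #>\<^bsub>G\<^esub> (cls w \<otimes>\<^bsub>G\<^esub> cls v \<otimes>\<^bsub>G\<^esub> inv\<^bsub>G\<^esub> cls w)"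
    unfolding coset_def using assms
    by (simp only: q.hom_mult q.hom_inv cls_closed G.m_closed G.inv_closed)
  also have "\<dots> = coset (w @ v @ inv_word w)"
    using assms by (simp add: coset_def cls_simps G.m_assoc)
  finally show ?thesis .
qed

lemma coset_eq_iff:
  assumes "v \<in> W" "w \<in> W"
  shows "coset v = coset w \<longleftrightarrow> alexander_proj D (fox v) = alexander_proj D (fox w)"
  unfolding coset_def cosets_eq_iff[OF assms] proj_eq_iff ..

text \<open>The inverse of the map induced by \<open>fox\<close>. A suitable word exists on the
  total quandle by \<open>carrier_total\<close>, and its coset is independent of the choice by
  \<open>coset_eq_iff\<close>.\<close>

definition metabelian_iso :: "('m arc \<Rightarrow>\<^sub>0 'm laurent) set \<Rightarrow> 'm arc word set set" where
  "metabelian_iso x = coset (SOME w. w \<in> W \<and> alexander_proj D (fox w) = x)"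

lemma metabelian_iso_fox:
  assumes w: "w \<in> W"
  shows "metabelian_iso (alexander_proj D (fox w)) = coset w"
proof -
  define v where "v = (SOME v. v \<in> W \<and> alexander_proj D (fox v) = alexander_proj D (fox w))"
  have "v \<in> W \<and> alexander_proj D (fox v) = alexander_proj D (fox w)"
    unfolding v_def by (rule someI[of _ w]) (use w in simp)
  then show ?thesis using coset_eq_iff w by (simp add: metabelian_iso_def flip: v_def)
qed

lemma metabelian_iso:
  "metabelian_iso \<in> quandle_iso (total_alexander_quandle D) (Conj (metabelian_quotient G))"
proof -
  have "inj_on metabelian_iso (carrier (total_alexander_quandle D))"
    by (auto simp: inj_on_def carrier_total metabelian_iso_fox coset_eq_iff)
  moreover have "metabelian_iso ` carrier (total_alexander_quandle D) = carrier (Conj (metabelian_quotient G))"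
    by (simp add: carrier_total carrier_Conj image_image metabelian_iso_fox cong: image_cong)
  ultimately show ?thesis
    by (auto simp: quandle_iso_def quandle_hom_def bij_betw_def carrier_total total_op_fox
        metabelian_iso_fox Conj_op_coset W_inv_word)
qed

section \<open>The natural image of the fundamental quandle\<close>

primrec quandle_word :: "'a qterm \<Rightarrow> 'a word" where
  "quandle_word (Gen a) = [(a, True)]"
| "quandle_word (Op x y) = quandle_word y @ quandle_word x @ inv_word (quandle_word y)"
| "quandle_word (Inv_op x y) = inv_word (quandle_word y) @ quandle_word x @ quandle_word y"

lemma quandle_word_W: "set_qterm x \<subseteq> arcs D \<Longrightarrow> quandle_word x \<in> W"
  by (induction x) (auto simp: W_inv_word)

text \<open>Conjugation satisfies the quandle axioms, and the quandle relation at a crossing becomes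
  the group relator there. Hence \<open>quandle_word\<close> induces a map on the fundamental
  quandle.\<close>

lemma qterm_eq_cls:
  assumes "qterm_eq (arcs D) (quandle_relations D) x y"
  shows "cls (quandle_word x) = cls (quandle_word y)"
proof -
  have cancel: "inv\<^bsub>G\<^esub> a \<otimes>\<^bsub>G\<^esub> (a \<otimes>\<^bsub>G\<^esub> b) = b" "a \<otimes>\<^bsub>G\<^esub> (inv\<^bsub>G\<^esub> a \<otimes>\<^bsub>G\<^esub> b) = b"
    if "a \<in> carrier G" "b \<in> carrier G" for a b
    using that by (simp_all flip: G.m_assoc)
  show ?thesis
    using assms
  proof induction
    case (op x x' y y')
    then show ?case using op.hyps[THEN qterm_eq_set] by (simp add: cls_simps quandle_word_W)
  next
    case (inv_op x x' y y')
    then show ?case using inv_op.hyps[THEN qterm_eq_set] by (simp add: cls_simps quandle_word_W)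
  next
    case (idem x)
    then show ?case by (simp add: cls_simps quandle_word_W)
  next
    case (inv1 x y)
    then show ?case by (simp add: cls_simps quandle_word_W G.m_assoc cancel)
  next
    case (inv2 x y)
    then show ?case by (simp add: cls_simps quandle_word_W G.m_assoc cancel)
  next
    case (distrib x y z)
    then show ?case by (simp add: cls_simps quandle_word_W G.m_assoc G.inv_mult_group cancel)
  next
    case (rel x y)
    then obtain c where c: "c \<in> crossings D" and
      xy: "x = Op (Gen (right_arc D c)) (Gen (over_arc D c))" "y = Gen (left_arc D c)"
      by (auto simp: quandle_relations_def)
    let ?x = "quandle_word x" and ?y = "quandle_word y"
    have W: "?x \<in> W" "?y \<in> W" using rel by (auto intro: quandle_word_W)
    have "?x @ inv_word ?y = [(over_arc D c, True), (right_arc D c, True), (over_arc D c, False), (left_arc D c, False)]"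
      by (simp add: xy)
    then have "cls (?x @ inv_word ?y) = \<one>\<^bsub>G\<^esub>" using relator(2)[OF c] by (simp add: cls_Nil)
    then have "cls ?x \<otimes>\<^bsub>G\<^esub> inv\<^bsub>G\<^esub> cls ?y = \<one>\<^bsub>G\<^esub>" using W by (simp add: cls_simps)
    from G.inv_equality[OF this] W show ?case by simp
  qed auto
qed

definition natural_map :: "'m arc qterm set \<Rightarrow> 'm arc word set set" where
  "natural_map A = coset (quandle_word (SOME x. x \<in> A))"

abbreviation "qcls x \<equiv> qterm_rel (arcs D) (quandle_relations D) `` {x}"

lemma natural_map_class:
  assumes "set_qterm x \<subseteq> arcs D"
  shows "natural_map (qcls x) = coset (quandle_word x)"
proof -
  have "x \<in> qcls x"
    using assms by (auto simp: qterm_rel_def intro: qterm_eq.refl)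
  then have "(SOME y. y \<in> qcls x) \<in> qcls x" by (rule someI)
  then have "qterm_eq (arcs D) (quandle_relations D) x (SOME y. y \<in> qcls x)"
    by (simp add: qterm_rel_def)
  from qterm_eq_cls[OF this] show ?thesis by (simp add: natural_map_def coset_def)
qed

lemma carrier_fundamental: "carrier (fundamental_quandle D) = qcls ` {x. set_qterm x \<subseteq> arcs D}"
  by (auto simp: fundamental_quandle_def presented_quandle_def quotient_def)

lemma natural_map_hom:
  "natural_map \<in> quandle_hom (fundamental_quandle D) (Conj (metabelian_quotient G))"
proof -
  have "natural_map (qcls x \<triangleright>\<^bsub>fundamental_quandle D\<^esub> qcls y) =
      natural_map (qcls x) \<triangleright>\<^bsub>Conj (metabelian_quotient G)\<^esub> natural_map (qcls y)"
    if "set_qterm x \<subseteq> arcs D" "set_qterm y \<subseteq> arcs D" for x y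
    using that by (simp add: fundamental_quandle_def presented_quandle_op natural_map_class Conj_op_coset quandle_word_W)
  then show ?thesis
    by (auto simp: quandle_hom_def carrier_fundamental carrier_Conj natural_map_class intro: quandle_word_W)
qed

text \<open>The generated subquandle consists of the values of quandle terms. For inverse
  operations, injectivity of right translations in the total quandle identifies the generated
  element with the value of an \<open>Inv_op\<close> term.\<close>

lemma carrier_fundamental_alexander:
  "carrier (fundamental_alexander_quandle D) =
    (\<lambda>x. alexander_proj D (fox (quandle_word x))) ` {x. set_qterm x \<subseteq> arcs D}"
proof -
  let ?U = "total_alexander_quandle D"
  let ?p = "\<lambda>w. alexander_proj D (fox w)"
  let ?S = "subquandle_gen ?U (alexander_gen D ` arcs D)"
  have gen: "alexander_gen D a = ?p (quandle_word (Gen a))" for a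
    by (simp add: alexander_gen_def scale_zero)
  have total: "?p w \<in> carrier ?U" if "w \<in> W" for w using that by (auto simp: carrier_total)
  have Inv_op_cancel: "?p (quandle_word (Inv_op x y)) \<triangleright>\<^bsub>?U\<^esub> ?p (quandle_word y) = ?p (quandle_word x)"
    if "set_qterm x \<subseteq> arcs D" "set_qterm y \<subseteq> arcs D" for x y
  proof -
    have "?p (quandle_word (Op (Inv_op x y) y)) = ?p (quandle_word x)"
      using qterm_eq_cls[OF qterm_eq.inv2[OF that]] that
      by (subst coset_eq_iff[symmetric]) (auto simp: coset_def quandle_word_W simp del: quandle_word.simps)
    then show ?thesis using that by (simp add: total_op_fox quandle_word_W W_inv_word)
  qed
  have "?p (quandle_word x) \<in> ?S" if "set_qterm x \<subseteq> arcs D" for x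
    using that
  proof (induction x)
    case (Gen a)
    then show ?case using gen by (auto intro: subquandle_gen.base simp del: quandle_word.simps)
  next
    case (Op x y)
    then show ?case using subquandle_gen.op[of "?p (quandle_word x)" ?U _ "?p (quandle_word y)"]
      by (simp add: total_op_fox quandle_word_W)
  next
    case (Inv_op x y)
    then have "?p (quandle_word x) \<in> ?S" "?p (quandle_word y) \<in> ?S" by auto
    then show ?case
      by (rule subquandle_gen.inv_op) (use Inv_op.prems Inv_op_cancel total quandle_word_W[of "Inv_op x y"] in auto)
  qed
  moreover have "\<exists>x. set_qterm x \<subseteq> arcs D \<and> z = ?p (quandle_word x)" if "z \<in> ?S" for z
    using that
  proof induction
    case (base z)
    then obtain a where "a \<in> arcs D" "z = alexander_gen D a" by auto
    then show ?case using gen by (intro exI[of _ "Gen a"]) simp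
  next
    case (op z1 z2)
    then obtain x y where "set_qterm x \<subseteq> arcs D" "z1 = ?p (quandle_word x)"
      "set_qterm y \<subseteq> arcs D" "z2 = ?p (quandle_word y)" by blast
    then show ?case by (intro exI[of _ "Op x y"]) (simp add: total_op_fox quandle_word_W)
  next
    case (inv_op z1 z2 z)
    then obtain x y where xy: "set_qterm x \<subseteq> arcs D" "z1 = ?p (quandle_word x)"
      "set_qterm y \<subseteq> arcs D" "z2 = ?p (quandle_word y)" by blast
    interpret U: quandle ?U by (rule quandle_total_alexander_quandle[OF diagram])
    have "z2 \<in> carrier ?U" "?p (quandle_word (Inv_op x y)) \<in> carrier ?U"
      using xy quandle_word_W[of "Inv_op x y"] by (auto intro!: total simp: quandle_word_W simp del: quandle_word.simps)
    then have "z = ?p (quandle_word (Inv_op x y))"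
      using bij_betw_imp_inj_on[OF U.bij, THEN inj_onD] inv_op.hyps Inv_op_cancel[OF xy(1,3)] xy by metis
    then show ?case using xy by (intro exI[of _ "Inv_op x y"]) simp
  qed
  ultimately show ?thesis by (auto simp: fundamental_alexander_quandle_def)
qed

text \<open>Both carriers are parametrized by quandle terms through the same words
  \<open>quandle_word x\<close>, and \<open>metabelian_iso\<close> takes the Fox derivative class of
  a word to its coset.\<close>

lemma metabelian_iso_fundamental:
  "metabelian_iso \<in> quandle_iso (fundamental_alexander_quandle D)
    ((Conj (metabelian_quotient G))\<lparr>carrier := natural_map ` carrier (fundamental_quandle D)\<rparr>)"
proof -
  have image: "metabelian_iso ` carrier (fundamental_alexander_quandle D) = natural_map ` carrier (fundamental_quandle D)"
    by (simp add: carrier_fundamental_alexander carrier_fundamental image_image metabelian_iso_fox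
        natural_map_class quandle_word_W cong: image_cong_simp)
  have sub: "carrier (fundamental_alexander_quandle D) \<subseteq> carrier (total_alexander_quandle D)"
    by (auto simp: carrier_fundamental_alexander carrier_total intro: quandle_word_W)
  have iso: "inj_on metabelian_iso (carrier (total_alexander_quandle D))"
    "\<And>x y. x \<in> carrier (total_alexander_quandle D) \<Longrightarrow> y \<in> carrier (total_alexander_quandle D) \<Longrightarrow>
      metabelian_iso (x \<triangleright>\<^bsub>total_alexander_quandle D\<^esub> y) =
      metabelian_iso x \<triangleright>\<^bsub>Conj (metabelian_quotient G)\<^esub> metabelian_iso y"
    using metabelian_iso by (auto simp: quandle_iso_def quandle_hom_def bij_betw_def)
  have op: "qop (fundamental_alexander_quandle D) = qop (total_alexander_quandle D)"
    by (simp add: fundamental_alexander_quandle_def)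
  have "metabelian_iso (x \<triangleright>\<^bsub>fundamental_alexander_quandle D\<^esub> y) =
      metabelian_iso x \<triangleright>\<^bsub>Conj (metabelian_quotient G)\<^esub> metabelian_iso y"
    if "x \<in> carrier (fundamental_alexander_quandle D)" "y \<in> carrier (fundamental_alexander_quandle D)" for x y
    unfolding op using that sub by (intro iso(2)) auto
  moreover have "bij_betw metabelian_iso (carrier (fundamental_alexander_quandle D)) (natural_map ` carrier (fundamental_quandle D))"
    unfolding bij_betw_def using inj_on_subset[OF iso(1) sub] image by blast
  moreover have "metabelian_iso \<in> carrier (fundamental_alexander_quandle D) \<rightarrow> natural_map ` carrier (fundamental_quandle D)"
    using image by blast
  ultimately show ?thesis
    by (simp add: quandle_iso_def quandle_hom_def)
qed

end

theorem theorem8: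
  fixes D :: "'m::finite link_diagram"
  assumes "virtual_link_diagram D"
  shows "quandle_iso (total_alexander_quandle D) (Conj (metabelian_quotient (link_group D))) \<noteq> {}
    \<and> (\<exists>\<Phi> \<nu>.
          \<Phi> \<in> quandle_iso (total_alexander_quandle D) (Conj (metabelian_quotient (link_group D)))
        \<and> \<nu> \<in> quandle_hom (fundamental_quandle D) (Conj (metabelian_quotient (link_group D)))
        \<and> (\<forall>a\<in>arcs D. \<nu> (quandle_gen D a) =
              second_derived (link_group D) #>\<^bsub>link_group D\<^esub> group_gen D a)
        \<and> \<Phi> \<in> quandle_iso (fundamental_alexander_quandle D)
              ((Conj (metabelian_quotient (link_group D)))\<lparr>carrier := \<nu> ` carrier (fundamental_quandle D)\<rparr>))"
proof -
  interpret diagram D by unfold_locales (rule assms)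
  have "natural_map (quandle_gen D a) = second_derived (link_group D) #>\<^bsub>link_group D\<^esub> group_gen D a"
    if "a \<in> arcs D" for a
    using natural_map_class[of "Gen a"] that
    by (simp add: quandle_gen_def group_gen_def coset_def cls_def)
  then show ?thesis
    using metabelian_iso natural_map_hom metabelian_iso_fundamental by blast
qed

end
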